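(* Let $H_o=N(\mathbf{0},\mathbf{I}_{p+1})$. Suppose that $\rho$ is such that conditions A3 and A4 hold, let $b\in(0,1)$, and suppose $g(\sigma_M)<b$. Furthermore, suppose that $g$ is convex and $$\phi(\sigma_{b,0})\ge\frac{[1-g(\sigma_M)]^2(1-b)}{2-[b+g(\sigma_M)]}.$$ Then $c_o=1/\phi(\sigma_{b,0})$, and for any value $c$ such that $$c_1:=\frac{\log(\sigma_M/\sigma_{b,0})}{b-g(\sigma_M)}<c\le\frac{1}{\phi(\sigma_{b,0})}=c_o,$$ the CM-estimate of regression (based on $\rho$, $b$ and tuning constant $c$) dominates the S-estimate of regression (based on the same $\rho$ and $b$) with respect to the maximum bias function; that is, $B_{CM}(\varepsilon)\le B_S(\varepsilon)$ for all $0<\varepsilon<\min\{b,1-b\}$, with strict inequality for at least one such $\varepsilon$. Furthermore, this range of values for $c$ is not empty.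
   Context: Model. $(y,\mathbf{x})\in\mathbb{R}\times\mathbb{R}^p$ has joint distribution $H_o=N(\mathbf{0},\mathbf{I}_{p+1})$. Notation and conditions. With $Z$ standard normal, $g(s)=E\rho(Z/s)$ for $s>0$; for $0\le\varepsilon<\min\{b,1-b\}$, $\sigma_{b,\varepsilon}=g^{-1}[(b-\varepsilon)/(1-\varepsilon)]$ and $\gamma_{b,\varepsilon}=g^{-1}[b/(1-\varepsilon)]$ (so $\sigma_{b,0}=g^{-1}(b)$); $c(\varepsilon)=\varepsilon^{-1}\log(\sigma_{b,\varepsilon}/\gamma_{b,\varepsilon})$ for $\varepsilon>0$; and $c_o=\inf\{c(\varepsilon):0<\varepsilon<b\}$, the infimum being over those $\varepsilon$ for which $c(\varepsilon)$ is defined, i.e. $0<\varepsilon<\min\{b,1-b\}$. A3 (for $\rho:\mathbb{R}\to[0,\infty)$): (i) $\rho$ is symmetric, nondecreasing on $[0,\infty)$, $\rho(0)=0$; (ii) $\rho$ is bounded with $\lim_{u\to\infty}\rho(u)=1$; (iii) $\rho$ has only finitely many discontinuities. A4: (i) $g$ is continuously differentiable; (ii) $\phi(s)=-s\,g'(s)$ is unimodal, with its maximum attained at $\sigma_M$. Maximum bias. For $0<\varepsilon<1$, $V_\varepsilon=\{(1-\varepsilon)H_o+\varepsilon H^*: H^* \text{ any probability distribution on }\mathbb{R}^{p+1}\}$. For an $\mathbb{R}^p$-valued functional $\mathbf{T}$ (with $\mathbf{T}(H_o)=\mathbf{0}$, weakly continuous at $H_o$), the asymptotic bias at $H$ is $b(\mathbf{T},H)=\|\mathbf{T}(H)\|$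 (Euclidean norm) if $\mathbf{T}(H)$ is defined and finite, and $b(\mathbf{T},H)=\infty$ otherwise; the maximum bias function is $B_{\mathbf{T}}(\varepsilon)=\sup\{b(\mathbf{T},H):H\in V_\varepsilon\}$. $B_S$ and $B_{CM}$ are the maximum bias functions of the slope functionals $\mathbf{T}_S$ and $\mathbf{T}_{CM}$ below. S-estimates. The S-estimates of intercept, slopes and scale $\{t_S(H),\mathbf{T}_S(H),\sigma_S(H)\}$ are the solution $(\alpha,\boldsymbol{\theta},\sigma)$ of the problem of minimizing $\sigma>0$ subject to the constraint $E_H[\rho((y-\alpha-\mathbf{x}'\boldsymbol{\theta})/\sigma)]\le b$. CM-estimates. For $c>0$, the CM-estimates $\{t_{CM}(H),\mathbf{T}_{CM}(H),\sigma_{CM}(H)\}$ are the solution $(\alpha,\boldsymbol{\theta},\sigma)$, $\sigma>0$, minimizing $c\,E_H[\rho((y-\alpha-\mathbf{x}'\boldsymbol{\theta})/\sigma)]+\log\sigma$ subject to the same constraint $E_H[\rho((y-\alpha-\mathbf{x}'\boldsymbol{\theta})/\sigma)]\le b$.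
   Formalization: When the S- or CM-minimization has no minimizer (possible for discontinuous ρ, where the strict inequality read literally can fail), limits with positive scale of minimizing feasible sequences count as solutions instead of the estimate being undefined with infinite bias. *)

theory Defs
  imports "HOL-Probability.Probability"
begin

text \<open>Conditions on \<open>\<rho>\<close>, and the quantities derived from it.\<close>

definition cond_A3 :: "(real \<Rightarrow> real) \<Rightarrow> bool" where
  "cond_A3 \<rho> \<longleftrightarrow>
     (\<forall>u. \<rho> u \<ge> 0) \<and>
     (\<forall>u. \<rho> (- u) = \<rho> u) \<and> mono_on {0..} \<rho> \<and> \<rho> 0 = 0 \<and>
     bounded (range \<rho>) \<and> (\<rho> \<longlongrightarrow> 1) at_top \<and>
     finite {u. \<not> isCont \<rho> u}"

definition g_fun :: "(real \<Rightarrow> real) \<Rightarrow> real \<Rightarrow> real" where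
  "g_fun \<rho> s = (\<integral>z. \<rho> (z / s) \<partial>(density lborel std_normal_density))"

definition phi_fun :: "(real \<Rightarrow> real) \<Rightarrow> real \<Rightarrow> real" where
  "phi_fun \<rho> s = - s * deriv (g_fun \<rho>) s"

text \<open>Unimodality is meant in the weak sense (nondecreasing up to the mode, nonincreasing after it).\<close>

definition unimodal_pos :: "(real \<Rightarrow> real) \<Rightarrow> real \<Rightarrow> bool" where
  "unimodal_pos f m \<longleftrightarrow> m > 0 \<and> mono_on {0<..m} f \<and> antimono_on {m..} f"

definition cond_A4 :: "(real \<Rightarrow> real) \<Rightarrow> real \<Rightarrow> bool" where
  "cond_A4 \<rho> \<sigma>M \<longleftrightarrow>
     g_fun \<rho> C1_differentiable_on {0<..} \<and> unimodal_pos (phi_fun \<rho>) \<sigma>M"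

definition sigma_be :: "(real \<Rightarrow> real) \<Rightarrow> real \<Rightarrow> real \<Rightarrow> real" where
  "sigma_be \<rho> b \<epsilon> = inv_into {0<..} (g_fun \<rho>) ((b - \<epsilon>) / (1 - \<epsilon>))"

definition gamma_be :: "(real \<Rightarrow> real) \<Rightarrow> real \<Rightarrow> real \<Rightarrow> real" where
  "gamma_be \<rho> b \<epsilon> = inv_into {0<..} (g_fun \<rho>) (b / (1 - \<epsilon>))"

definition c_fun :: "(real \<Rightarrow> real) \<Rightarrow> real \<Rightarrow> real \<Rightarrow> real" where
  "c_fun \<rho> b \<epsilon> = ln (sigma_be \<rho> b \<epsilon> / gamma_be \<rho> b \<epsilon>) / \<epsilon>"

text \<open>
  The infimum defining \<open>c\<^sub>o\<close> runs over those \<open>\<epsilon>\<close> for which \<open>c(\<epsilon>)\<close> is defined. If \<open>\<rho>\<close> is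
  continuous at 0, then \<open>g\<close> maps onto \<open>(0, 1)\<close> and the two range conditions below hold
  automatically. If \<open>\<rho>\<close> jumps at 0, then \<open>g\<close> is bounded away from 0, and \<open>\<sigma>\<^bsub>b,\<epsilon>\<^esub>\<close> does not exist
  for \<open>\<epsilon>\<close> close to \<open>b\<close>; without the range conditions, \<open>inv_into\<close> would contribute arbitrary values.
\<close>

definition c_o :: "(real \<Rightarrow> real) \<Rightarrow> real \<Rightarrow> real" where
  "c_o \<rho> b = Inf (c_fun \<rho> b ` {\<epsilon>. 0 < \<epsilon> \<and> \<epsilon> < min b (1 - b) \<and>
     (b - \<epsilon>) / (1 - \<epsilon>) \<in> g_fun \<rho> ` {0<..} \<and> b / (1 - \<epsilon>) \<in> g_fun \<rho> ` {0<..}})"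

definition c_1 :: "(real \<Rightarrow> real) \<Rightarrow> real \<Rightarrow> real \<Rightarrow> real" where
  "c_1 \<rho> b \<sigma>M = ln (\<sigma>M / sigma_be \<rho> b 0) / (b - g_fun \<rho> \<sigma>M)"

text \<open>
  A distribution of \<open>(y, x)\<close> is a probability measure on the Borel sets of \<open>real \<times> 'a\<close>, where
  \<open>'a\<close> is instantiated to \<open>real ^ 'p\<close>.
\<close>

definition std_normal_vec :: "'a::euclidean_space measure" where
  "std_normal_vec = density lborel (\<lambda>z. ennreal (\<Prod>i\<in>Basis. std_normal_density (z \<bullet> i)))"

definition H_o :: "(real \<times> 'a::euclidean_space) measure" where
  "H_o = std_normal_vec"

definition distribution :: "'a::topological_space measure \<Rightarrow> bool" where
  "distribution H \<longleftrightarrow> prob_space H \<and> sets H = sets borel"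

definition contam_nbhd :: "real \<Rightarrow> (real \<times> 'a::euclidean_space) measure set" where
  "contam_nbhd \<epsilon> = {H. sets H = sets borel \<and>
     (\<exists>Hstar. distribution Hstar \<and>
        (\<forall>A\<in>sets borel. emeasure H A =
           ennreal (1 - \<epsilon>) * emeasure H_o A + ennreal \<epsilon> * emeasure Hstar A))}"

text \<open>
  A slope functional is partial: \<open>None\<close> means that it is not defined at the distribution.
\<close>

definition bias ::
  "((real \<times> 'a::euclidean_space) measure \<Rightarrow> 'a option) \<Rightarrow> (real \<times> 'a) measure \<Rightarrow> ereal" where
  "bias T H = (case T H of None \<Rightarrow> \<infinity> | Some \<theta> \<Rightarrow> ereal (norm \<theta>))"

definition max_bias ::
  "((real \<times> 'a::euclidean_space) measure \<Rightarrow> 'a option) \<Rightarrow> real \<Rightarrow> ereal" where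
  "max_bias T \<epsilon> = (SUP H\<in>contam_nbhd \<epsilon>. bias T H)"

text \<open>Parameters are triples \<open>(\<alpha>, \<theta>, \<sigma>)\<close>: intercept, slopes, scale.\<close>

definition mean_rho ::
  "(real \<Rightarrow> real) \<Rightarrow> (real \<times> 'a::euclidean_space) measure \<Rightarrow> real \<times> 'a \<times> real \<Rightarrow> real" where
  "mean_rho \<rho> H = (\<lambda>(\<alpha>, \<theta>, \<sigma>). (\<integral>z. \<rho> ((fst z - \<alpha> - snd z \<bullet> \<theta>) / \<sigma>) \<partial>H))"

definition feasible ::
  "(real \<Rightarrow> real) \<Rightarrow> real \<Rightarrow> (real \<times> 'a::euclidean_space) measure \<Rightarrow> real \<times> 'a \<times> real \<Rightarrow> bool" where
  "feasible \<rho> b H = (\<lambda>(\<alpha>, \<theta>, \<sigma>). \<sigma> > 0 \<and> mean_rho \<rho> H (\<alpha>, \<theta>, \<sigma>) \<le> b)"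

definition S_objective :: "real \<times> 'a \<times> real \<Rightarrow> real" where
  "S_objective = (\<lambda>(\<alpha>, \<theta>, \<sigma>). \<sigma>)"

definition CM_objective ::
  "(real \<Rightarrow> real) \<Rightarrow> real \<Rightarrow> (real \<times> 'a::euclidean_space) measure \<Rightarrow> real \<times> 'a \<times> real \<Rightarrow> real" where
  "CM_objective \<rho> c H = (\<lambda>(\<alpha>, \<theta>, \<sigma>). c * mean_rho \<rho> H (\<alpha>, \<theta>, \<sigma>) + ln \<sigma>)"

text \<open>
  A solution is a minimizer of the objective \<open>F\<close> over the feasible parameters \<open>P\<close>. Conditions
  on \<open>\<rho>\<close> that allow discontinuities do not force the minimum to be attained: for
  \<open>\<rho>(u) = 1\<close> if \<open>\<bar>u\<bar> \<ge> 1\<close> and \<open>0\<close> otherwise, and \<open>H = (1 - \<epsilon>) H\<^sub>o + \<epsilon> \<delta>\<close> with a suitable point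
  mass \<open>\<delta>\<close>, the infimum of \<open>\<sigma>\<close> is not attained. Only when no minimizer exists, the solutions
  are the limits (with positive scale) of minimizing sequences. For lower semicontinuous \<open>\<rho>\<close>
  and \<open>H\<close> in the contamination neighbourhoods with \<open>\<epsilon> < min b (1 - b)\<close> a minimizer always exists,
  so that this second case does not arise.
\<close>

definition minimizing_limit ::
  "(real \<times> 'a::euclidean_space \<times> real \<Rightarrow> real) \<Rightarrow> (real \<times> 'a \<times> real \<Rightarrow> bool) \<Rightarrow>
     real \<times> 'a \<times> real \<Rightarrow> bool" where
  "minimizing_limit F P q \<longleftrightarrow> snd (snd q) > 0 \<and>
     (\<exists>X. (\<forall>n. P (X n)) \<and> X \<longlonglongrightarrow> q \<and>
          (\<forall>q'. P q' \<longrightarrow> (\<forall>e>0. \<forall>\<^sub>F n in sequentially. F (X n) < F q' + e)))"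

definition solution ::
  "(real \<times> 'a::euclidean_space \<times> real \<Rightarrow> real) \<Rightarrow> (real \<times> 'a \<times> real \<Rightarrow> bool) \<Rightarrow>
     real \<times> 'a \<times> real \<Rightarrow> bool" where
  "solution F P q \<longleftrightarrow>
     (if \<exists>q'. is_arg_min F P q' then is_arg_min F P q else minimizing_limit F P q)"

text \<open>
  Solutions need not be unique, so a slope functional of S- or CM-type is any function that
  selects the slopes of a solution whenever there is one.
\<close>

definition selects_slopes ::
  "((real \<times> 'a::euclidean_space) measure \<Rightarrow> real \<times> 'a \<times> real \<Rightarrow> bool) \<Rightarrow>
     ((real \<times> 'a) measure \<Rightarrow> 'a option) \<Rightarrow> bool" where
  "selects_slopes sol T \<longleftrightarrow> (\<forall>H. distribution H \<longrightarrow>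
     (case T H of None \<Rightarrow> \<not> (\<exists>q. sol H q) | Some \<theta> \<Rightarrow> (\<exists>\<alpha> \<sigma>. sol H (\<alpha>, \<theta>, \<sigma>))))"

definition S_slope ::
  "(real \<Rightarrow> real) \<Rightarrow> real \<Rightarrow> ((real \<times> 'a::euclidean_space) measure \<Rightarrow> 'a option) \<Rightarrow> bool" where
  "S_slope \<rho> b T \<longleftrightarrow> selects_slopes (\<lambda>H. solution S_objective (feasible \<rho> b H)) T"

definition CM_slope ::
  "(real \<Rightarrow> real) \<Rightarrow> real \<Rightarrow> real \<Rightarrow>
     ((real \<times> 'a::euclidean_space) measure \<Rightarrow> 'a option) \<Rightarrow> bool" where
  "CM_slope \<rho> b c T \<longleftrightarrow>
     selects_slopes (\<lambda>H. solution (CM_objective \<rho> c H) (feasible \<rho> b H)) T"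

definition dominates ::
  "real \<Rightarrow> ((real \<times> 'a::euclidean_space) measure \<Rightarrow> 'a option) \<Rightarrow>
     ((real \<times> 'a) measure \<Rightarrow> 'a option) \<Rightarrow> bool" where
  "dominates b T T' \<longleftrightarrow>
     (\<forall>\<epsilon>. 0 < \<epsilon> \<and> \<epsilon> < min b (1 - b) \<longrightarrow> max_bias T \<epsilon> \<le> max_bias T' \<epsilon>) \<and>
     (\<exists>\<epsilon>. 0 < \<epsilon> \<and> \<epsilon> < min b (1 - b) \<and> max_bias T \<epsilon> < max_bias T' \<epsilon>)"

end

theory Submission
  imports Defs "HOL-Complex_Analysis.Complex_Analysis"
begin

text \<open>
  Write \<open>u = g(s)\<close>, \<open>\<phi>\<^sub>0 = \<phi>(\<sigma>\<^bsub>b,0\<^esub>)\<close> and \<open>A(s) = c (1 - \<epsilon>) g(s) + ln s\<close>. Everything rests on the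
  inequality \<open>\<phi>\<^sub>0 ln (s / \<gamma>\<^bsub>b,\<epsilon>\<^esub>) \<ge> b - (1 - \<epsilon>) u\<close> for \<open>\<gamma>\<^bsub>b,\<epsilon>\<^esub> \<le> s \<le> \<sigma>\<^bsub>b,\<epsilon>\<^esub>\<close>, strict beyond \<open>\<sigma>\<^bsub>b,0\<^esub>\<close>. To the
  left of \<open>\<sigma>\<^bsub>b,0\<^esub>\<close> it holds because \<open>\<phi> \<le> \<phi>\<^sub>0\<close> there, to the right because \<open>g\<close> lies above its tangent
  and \<open>\<phi>\<^sub>0 \<ge> (1 - b)\<^sup>2 / 2\<close>. At \<open>s = \<sigma>\<^bsub>b,\<epsilon>\<^esub>\<close> it says \<open>c(\<epsilon>) > 1 / \<phi>\<^sub>0\<close>, which gives \<open>c\<^sub>o\<close>; for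
  \<open>c \<le> 1 / \<phi>\<^sub>0\<close> it says \<open>A(s) \<ge> A(\<gamma>\<^bsub>b,\<epsilon>\<^esub>)\<close>.

  A point mass far out on a regression line shows that the maximum bias of the S-estimate
  is at least \<open>sqrt ((\<sigma>\<^bsub>b,\<epsilon>\<^esub> / \<gamma>\<^bsub>b,\<epsilon>\<^esub>)\<^sup>2 - 1)\<close>. A CM-solution \<open>(\<alpha>, \<theta>, \<sigma>)\<close> has standardized scale
  \<open>s = \<sigma> / sqrt (1 + |\<theta>|\<^sup>2) \<ge> \<gamma>\<^bsub>b,\<epsilon>\<^esub>\<close>; comparing it with the fit \<open>\<theta> = 0\<close> of scale \<open>s\<close> if \<open>s \<ge> \<sigma>\<^bsub>b,\<epsilon>\<^esub>\<close>
  and of scale \<open>\<sigma>\<^bsub>b,\<epsilon>\<^esub>\<close> otherwise bounds \<open>ln sqrt (1 + |\<theta>|\<^sup>2)\<close> by \<open>c \<epsilon>\<close> or by \<open>ln (\<sigma>\<^bsub>b,\<epsilon>\<^esub> / \<gamma>\<^bsub>b,\<epsilon>\<^esub>)\<close>.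
  The range of \<open>c\<close> could be empty only if \<open>\<phi>\<close> were constant on \<open>[\<sigma>\<^bsub>b,0\<^esub>, \<sigma>\<^sub>M]\<close>, which analyticity of
  \<open>g\<close> excludes.
\<close>

section \<open>Projections of the standard normal distribution\<close>

lemma borel_measurable_cis [measurable]:
  "f \<in> borel_measurable M \<Longrightarrow> (\<lambda>x. cis (f x)) \<in> borel_measurable M"
  by (rule measurable_compose[OF _ borel_measurable_continuous_onI])
     (auto intro!: continuous_intros)

text \<open>Density and exponential both factor over the coordinates, so the integral is a product
  of one-dimensional characteristic functions, and the exponents add up to the squared norm of
  \<open>v\<close>. The degenerate case \<open>t = 0\<close> also gives the total mass of the
  density.\<close>

lemma normal_prod_integral:
  fixes v :: "'a::euclidean_space" and t :: real
  shows "integrable lborel (\<lambda>z::'a. cis (t * (z \<bullet> v)) * of_real (\<Prod>i\<in>Basis. std_normal_density (z \<bullet> i)))" (is ?I)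
    and "(\<integral>z. cis (t * (z \<bullet> v)) * of_real (\<Prod>i\<in>Basis. std_normal_density (z \<bullet> i)) \<partial>lborel)
           = of_real (exp (- (t * norm v)\<^sup>2 / 2))" (is ?E)
proof -
  interpret product_sigma_finite "\<lambda>_::'a. lborel :: real measure"
    by standard
  define f where "f i x = cis (t * (v \<bullet> i) * x) * of_real (std_normal_density x)" for i :: 'a and x :: real
  have f_int: "integrable lborel (f i)" for i
  proof -
    have "integrable std_normal_distribution (\<lambda>x. cis (t * (v \<bullet> i) * x))"
      by (intro finite_measure.integrable_const_bound[where B=1] prob_space.finite_measure
           prob_space_normal_density) auto
    then show ?thesis
      by (subst (asm) integrable_density) (auto simp: f_def[abs_def] scaleR_conv_of_real mult_ac)
  qed
  have f_eq: "(\<integral>x. f i x \<partial>lborel) = of_real (exp (- (t * (v \<bullet> i))\<^sup>2 / 2))" for i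
  proof -
    have "(\<integral>x. f i x \<partial>lborel) = char std_normal_distribution (t * (v \<bullet> i))"
      unfolding char_def f_def
      by (subst integral_density) (auto simp: scaleR_conv_of_real mult.commute cis_conv_exp)
    then show ?thesis by (simp add: char_std_normal_distribution)
  qed
  have cis_sum: "cis (\<Sum>i\<in>A. h i) = (\<Prod>i\<in>A. cis (h i))" if "finite A" for A :: "'a set" and h
    using that by (induction A rule: finite_induct) (auto simp: cis_mult[symmetric])
  have prod_eq: "cis (t * ((\<Sum>b\<in>Basis. x b *\<^sub>R b) \<bullet> v)) *
      of_real (\<Prod>i\<in>Basis. std_normal_density ((\<Sum>b\<in>Basis. x b *\<^sub>R b) \<bullet> i)) = (\<Prod>i\<in>Basis. f i (x i))"
    for x :: "'a \<Rightarrow> real"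
  proof -
    have "(\<Sum>b\<in>Basis. x b *\<^sub>R b) \<bullet> v = (\<Sum>b\<in>Basis. x b * (v \<bullet> b))"
      by (simp add: inner_sum_left inner_commute[of v])
    then show ?thesis
      by (simp add: f_def prod.distrib sum_distrib_left cis_sum of_real_prod mult_ac)
  qed
  have [measurable]: "(\<lambda>f. \<Sum>b\<in>Basis. f b *\<^sub>R (b::'a)) \<in> (\<Pi>\<^sub>M b\<in>Basis. lborel) \<rightarrow>\<^sub>M borel"
    by (auto intro!: borel_measurable_sum borel_measurable_scaleR)
  show ?I
  proof (subst lborel_eq, subst integrable_distr_eq)
    show "integrable (\<Pi>\<^sub>M b\<in>Basis. lborel) (\<lambda>x. cis (t * ((\<Sum>b\<in>Basis. x b *\<^sub>R b) \<bullet> v)) *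
      of_real (\<Prod>i\<in>Basis. std_normal_density ((\<Sum>b\<in>Basis. x b *\<^sub>R b) \<bullet> i)))"
      unfolding prod_eq by (intro product_integrable_prod f_int) simp
  qed measurable
  have "(\<Sum>i\<in>Basis. (t * (v \<bullet> i))\<^sup>2) = (t * norm v)\<^sup>2"
    unfolding power_mult_distrib sum_distrib_left[symmetric] power2_norm_eq_inner euclidean_inner[of v v]
    by (simp add: power2_eq_square)
  then have "(\<Prod>i\<in>Basis. exp (- (t * (v \<bullet> i))\<^sup>2 / 2)) = exp (- (t * norm v)\<^sup>2 / 2)"
    by (simp add: exp_sum[symmetric] sum_negf sum_divide_distrib[symmetric])
  then have "(\<Prod>i\<in>Basis. complex_of_real (exp (- (t * (v \<bullet> i))\<^sup>2 / 2))) = of_real (exp (- (t * norm v)\<^sup>2 / 2))"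
    by (metis of_real_prod)
  moreover have "(\<integral>z. cis (t * (z \<bullet> v)) * of_real (\<Prod>i\<in>Basis. std_normal_density (z \<bullet> i)) \<partial>lborel)
     = (\<integral>x. (\<Prod>i\<in>Basis. f i (x i)) \<partial>(\<Pi>\<^sub>M b\<in>Basis. lborel))"
    unfolding prod_eq[symmetric]
    by (subst lborel_eq, rule integral_distr) measurable
  ultimately show ?E
    by (simp add: product_integral_prod f_int f_eq)
qed

lemma prob_space_std_normal_vec: "prob_space (std_normal_vec :: 'a::euclidean_space measure)"
proof
  have "integrable lborel (\<lambda>z::'a. complex_of_real (\<Prod>i\<in>Basis. std_normal_density (z \<bullet> i)))"
    using normal_prod_integral(1)[of 0 "0::'a"] by simp
  then have int: "integrable lborel (\<lambda>z::'a. \<Prod>i\<in>Basis. std_normal_density (z \<bullet> i))"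
    unfolding complex_of_real_integrable_eq .
  have "complex_of_real (\<integral>z. (\<Prod>i\<in>Basis. std_normal_density ((z::'a) \<bullet> i)) \<partial>lborel) = 1"
    using normal_prod_integral(2)[of 0 "0::'a"] 
    by (subst integral_complex_of_real[symmetric]) simp
  then have "(\<integral>z. (\<Prod>i\<in>Basis. std_normal_density ((z::'a) \<bullet> i)) \<partial>lborel) = 1"
    using of_real_eq_1_iff by blast
  then show "emeasure (std_normal_vec :: 'a measure) (space std_normal_vec) = 1"
    unfolding std_normal_vec_def
    using nn_integral_eq_integral[OF int] by (simp add: emeasure_density prod_nonneg)
qed

lemma sets_std_normal_vec [simp, measurable_cong]: "sets std_normal_vec = sets borel"
  by (simp add: std_normal_vec_def)

text \<open>Both sides have the characteristic function
  \<open>exp (- (t * norm v)\<^sup>2 / 2)\<close>, and characteristic functions determine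
  distributions on the line.\<close>

lemma distr_std_normal_vec_inner:
  fixes v :: "'a::euclidean_space"
  shows "distr std_normal_vec borel (\<lambda>z. z \<bullet> v) = distr std_normal_distribution borel (\<lambda>x. norm v * x)"
proof (rule Levy_uniqueness)
  interpret V: prob_space "std_normal_vec :: 'a measure" by (rule prob_space_std_normal_vec)
  interpret N: prob_space std_normal_distribution by (rule prob_space_normal_density) simp
  show "real_distribution (distr std_normal_vec borel (\<lambda>z. z \<bullet> v))"
    by (rule V.real_distribution_distr) simp
  show "real_distribution (distr std_normal_distribution borel (\<lambda>x. norm v * x))"
    by (rule N.real_distribution_distr) simp
  show "char (distr std_normal_vec borel (\<lambda>z. z \<bullet> v)) = char (distr std_normal_distribution borel (\<lambda>x. norm v * x))"
  proof
    fix t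
    have "char (distr std_normal_vec borel (\<lambda>z. z \<bullet> v)) t = of_real (exp (- (t * norm v)\<^sup>2 / 2))"
      unfolding char_def normal_prod_integral(2)[symmetric]
      by (subst integral_distr)
         (auto simp: std_normal_vec_def integral_density prod_nonneg cis_conv_exp scaleR_conv_of_real mult.commute)
    moreover have "char (distr std_normal_distribution borel (\<lambda>x. norm v * x)) t = char std_normal_distribution (t * norm v)"
      unfolding char_def by (subst integral_distr) (auto simp: mult_ac)
    ultimately show "char (distr std_normal_vec borel (\<lambda>z. z \<bullet> v)) t = char (distr std_normal_distribution borel (\<lambda>x. norm v * x)) t"
      by (simp add: char_std_normal_distribution)
  qed
qed

lemma integral_std_normal_vec_inner:
  fixes v :: "'a::euclidean_space" and f :: "real \<Rightarrow> real"
  assumes [measurable]: "f \<in> borel_measurable borel"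
  shows "(\<integral>z. f (z \<bullet> v) \<partial>std_normal_vec) = (\<integral>x. f (norm v * x) \<partial>std_normal_distribution)"
proof -
  have "(\<integral>z. f (z \<bullet> v) \<partial>std_normal_vec) = (\<integral>x. f x \<partial>distr std_normal_vec borel (\<lambda>z. z \<bullet> v))"
    by (subst integral_distr) auto
  also have "\<dots> = (\<integral>x. f (norm v * x) \<partial>std_normal_distribution)"
    unfolding distr_std_normal_vec_inner by (subst integral_distr) auto
  finally show ?thesis .
qed

text \<open>One-dimensional Anderson inequality; it will show that a nonzero intercept cannot lower
  a Gaussian average of \<rho>. Centring both integrals at \<open>m/2\<close> writes their
  difference as the integral of \<open>n (m/2 + w) * q w\<close> with \<open>q\<close> odd.
  Averaging with the reflected integral replaces the weight by
  \<open>n (m/2 + w) - n (- m/2 + w)\<close>, up to a factor 2, and this always has the sign of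
  \<open>q w\<close>.\<close>

lemma anderson_real:
  fixes r :: "real \<Rightarrow> real"
  assumes [measurable]: "r \<in> borel_measurable borel"
    and bnd: "\<And>x. \<bar>r x\<bar> \<le> B"
    and mono: "\<And>x y. \<bar>x\<bar> \<le> \<bar>y\<bar> \<Longrightarrow> r x \<le> r y"
  shows "(\<integral>x. r x \<partial>std_normal_distribution) \<le> (\<integral>x. r (x - m) \<partial>std_normal_distribution)"
proof -
  define n where "n = std_normal_density"
  have [measurable]: "n \<in> borel_measurable borel" by (simp add: n_def)
  have n_int: "integrable lborel (\<lambda>x. n (c + x) * h x)" 
    if [measurable]: "h \<in> borel_measurable borel" and "\<And>x. \<bar>h x\<bar> \<le> C" for h c C
  proof (rule Bochner_Integration.integrable_bound)
    show "integrable lborel (\<lambda>x. C * n (c + x))"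
      using lborel_integrable_real_affine[of n 1 c] integrable_std_normal_moment[of 0] 
      by (auto simp: n_def)
    show "AE x in lborel. norm (n (c + x) * h x) \<le> norm (C * n (c + x))"
      using that by (intro AE_I2) (auto simp: n_def abs_mult mult_mono' mult.commute intro!: mult_mono order_trans[OF that(2)])
  qed measurable
  define q where "q w = r (w - m/2) - r (w + m/2)" for w
  have [measurable]: "q \<in> borel_measurable borel" by (simp add: q_def[abs_def])
  have r_even: "r (- x) = r x" for x by (intro antisym mono) auto
  have q_odd: "q (- w) = - q w" for w
    using r_even[of "w + m/2"] r_even[of "w - m/2"] by (simp add: q_def algebra_simps)
  have q_bnd: "\<bar>q w\<bar> \<le> 2 * B" for w
    using bnd[of "w - m/2"] bnd[of "w + m/2"] by (auto simp: q_def)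
  have n_even: "n (- x) = n x" for x by (simp add: n_def std_normal_density_def)
  have n_mono: "n y \<le> n x" if "\<bar>x\<bar> \<le> \<bar>y\<bar>" for x y
    using abs_le_square_iff[of x y] that by (simp add: n_def std_normal_density_def divide_right_mono)
  have i1: "integrable lborel (\<lambda>w. n (m/2 + w) * r (w - m/2))"
    by (rule n_int[where C=B]) (use bnd in auto)
  have i2: "integrable lborel (\<lambda>w. n (m/2 + w) * r (w + m/2))"
    by (rule n_int[where C=B]) (use bnd in auto)
  have a1: "(\<integral>x. r (x - m) \<partial>std_normal_distribution) = (\<integral>w. n (m/2 + w) * r (w - m/2) \<partial>lborel)"
    by (subst integral_density, simp_all, subst lborel_integral_real_affine[of 1 _ "m/2"]) 
       (auto simp: n_def algebra_simps)
  have a2: "(\<integral>x. r x \<partial>std_normal_distribution) = (\<integral>w. n (m/2 + w) * r (w + m/2) \<partial>lborel)"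
    by (subst integral_density, simp_all, subst lborel_integral_real_affine[of 1 _ "m/2"]) 
       (auto simp: n_def algebra_simps)
  let ?D = "\<integral>w. n (m/2 + w) * q w \<partial>lborel"
  have D: "(\<integral>x. r (x - m) \<partial>std_normal_distribution) - (\<integral>x. r x \<partial>std_normal_distribution) = ?D"
    unfolding a1 a2 by (subst Bochner_Integration.integral_diff[symmetric]) (auto simp: q_def algebra_simps i1[simplified algebra_simps] i2[simplified algebra_simps] i1 i2)
  have D': "?D = (\<integral>w. - (n (- m/2 + w) * q w) \<partial>lborel)"
  proof -
    have e: "n (m/2 - w) = n (w - m/2)" for w using n_even[of "w - m/2"] by simp
    show ?thesis
    by (subst lborel_integral_real_affine[of "-1" _ 0]) (auto simp: q_odd e)
  qed
  have "0 \<le> (\<integral>w. (n (m/2 + w) - n (- m/2 + w)) * q w \<partial>lborel)"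
  proof (rule integral_nonneg_AE, rule AE_I2)
    fix w
    show "0 \<le> (n (m/2 + w) - n (- m/2 + w)) * q w"
    proof (cases "\<bar>w - m/2\<bar> \<le> \<bar>w + m/2\<bar>")
      case True
      then show ?thesis using mono[of "w - m/2" "w + m/2"] n_mono[of "w - m/2" "w + m/2"]
        by (intro mult_nonpos_nonpos) (auto simp: q_def add_ac)
    next
      case False
      then show ?thesis using mono[of "w + m/2" "w - m/2"] n_mono[of "w + m/2" "w - m/2"]
        by (intro mult_nonneg_nonneg) (auto simp: q_def add_ac)
    qed
  qed
  also have "\<dots> = ?D + (\<integral>w. - (n (- m/2 + w) * q w) \<partial>lborel)"
    using n_int[of q "2 * B" "m/2"] n_int[of q "2 * B" "- m/2"] q_bnd
    by (subst Bochner_Integration.integral_add[symmetric])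
       (auto simp: algebra_simps)
  finally have "0 \<le> ?D" using D' by simp
  then show ?thesis using D by simp
qed

section \<open>Contaminated distributions\<close>

text \<open>Contamination neighbourhoods are described by measures of sets; the usual induction over
  simple functions and monotone limits carries the mixture formula to integrals.\<close>

lemma nn_integral_mixture:
  assumes [measurable_cong]: "sets H = sets M" "sets N = sets M"
    and mix: "\<And>A. A \<in> sets M \<Longrightarrow> emeasure H A = p * emeasure M A + q * emeasure N A"
    and "f \<in> borel_measurable M"
  shows "(\<integral>\<^sup>+x. f x \<partial>H) = p * (\<integral>\<^sup>+x. f x \<partial>M) + q * (\<integral>\<^sup>+x. f x \<partial>N)"
  using assms(4)
proof (induction f rule: borel_measurable_induct)
  case (cong f g)
  have "space H = space M" "space N = space M" using assms sets_eq_imp_space_eq by blast+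
  then have "(\<integral>\<^sup>+x. f x \<partial>H) = (\<integral>\<^sup>+x. g x \<partial>H)" "(\<integral>\<^sup>+x. f x \<partial>N) = (\<integral>\<^sup>+x. g x \<partial>N)"
    using cong.hyps(3) by (metis (mono_tags, lifting) nn_integral_cong)+
  moreover have "(\<integral>\<^sup>+x. f x \<partial>M) = (\<integral>\<^sup>+x. g x \<partial>M)"
    using cong by (auto intro!: nn_integral_cong)
  ultimately show ?case using cong by simp
next
  case (set A)
  then show ?case using assms(1,2) by (simp add: mix)
next
  case (mult u c)
  have [measurable]: "u \<in> borel_measurable M" by fact
  then have "u \<in> borel_measurable H" "u \<in> borel_measurable N" by measurable
  with mult show ?case by (simp add: nn_integral_cmult algebra_simps)
next
  case (add u v)
  have [measurable]: "u \<in> borel_measurable M" "v \<in> borel_measurable M" by fact+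
  then have "u \<in> borel_measurable H" "u \<in> borel_measurable N" "v \<in> borel_measurable H" "v \<in> borel_measurable N"
    by measurable
  with add show ?case by (simp add: nn_integral_add algebra_simps)
next
  case (seq U)
  have [measurable]: "U i \<in> borel_measurable M" for i by fact
  then have m: "U i \<in> borel_measurable H" "U i \<in> borel_measurable N" for i by measurable
  have inc: "incseq (\<lambda>i. integral\<^sup>N X (U i))" for X
    using \<open>incseq U\<close> by (auto simp: mono_def le_fun_def intro!: nn_integral_mono)
  have "(\<integral>\<^sup>+x. (SUP i. U i x) \<partial>H) = (SUP i. p * integral\<^sup>N M (U i) + q * integral\<^sup>N N (U i))"
    using seq m by (simp add: nn_integral_monotone_convergence_SUP)
  also have "\<dots> = (SUP i. p * integral\<^sup>N M (U i)) + (SUP i. q * integral\<^sup>N N (U i))"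
    using inc[of M] inc[of N]
    by (intro ennreal_SUP_add) (auto simp: mono_def intro!: mult_left_mono)
  also have "\<dots> = p * (\<integral>\<^sup>+x. (SUP i. U i x) \<partial>M) + q * (\<integral>\<^sup>+x. (SUP i. U i x) \<partial>N)"
    using seq m by (simp add: nn_integral_monotone_convergence_SUP SUP_mult_left_ennreal)
  finally show ?case by (simp add: image_comp)
qed

text \<open>Needed for lower bounds on the maximum bias, where a particular contaminated
  distribution has to be exhibited.\<close>

lemma ex_mixture:
  assumes "sets N = sets M"
  obtains H where "sets H = sets M"
    "\<And>A. A \<in> sets M \<Longrightarrow> emeasure H A = p * emeasure M A + q * emeasure N A"
proof
  let ?\<mu> = "\<lambda>A. p * emeasure M A + q * emeasure N A"
  define H where "H = measure_of (space M) (sets M) ?\<mu>"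
  show "sets H = sets M" by (simp add: H_def)
  have "countably_additive (sets M) ?\<mu>"
  proof (rule countably_additiveI)
    fix A :: "nat \<Rightarrow> _" assume A: "range A \<subseteq> sets M" "disjoint_family A" "\<Union> (range A) \<in> sets M"
    have "(\<Sum>i. ?\<mu> (A i)) = (\<Sum>i. p * emeasure M (A i)) + (\<Sum>i. q * emeasure N (A i))"
      by (rule suminf_add[symmetric]) auto
    also have "\<dots> = ?\<mu> (\<Union> (range A))"
      using A assms by (simp add: ennreal_suminf_cmult suminf_emeasure)
    finally show "(\<Sum>i. ?\<mu> (A i)) = ?\<mu> (\<Union> (range A))" .
  qed
  then show "emeasure H A = ?\<mu> A" if "A \<in> sets M" for A
    unfolding H_def using that
    by (intro emeasure_measure_of_sigma) (auto simp: positive_def sets.sigma_algebra_axioms)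
qed

lemma sets_H_o [simp, measurable_cong]: "sets H_o = sets borel"
  by (simp add: H_o_def)

lemma prob_space_H_o: "prob_space H_o"
  by (simp add: H_o_def prob_space_std_normal_vec)

text \<open>Slope functionals are specified only at distributions, so this is what makes them usable
  on the neighbourhood.\<close>

lemma distribution_contam:
  fixes H :: "(real \<times> 'a::euclidean_space) measure"
  assumes "H \<in> contam_nbhd \<epsilon>" "0 \<le> \<epsilon>" "\<epsilon> \<le> 1"
  shows "distribution H"
proof -
  obtain Hs where H: "sets H = sets borel" "distribution Hs"
    "\<And>A. A \<in> sets borel \<Longrightarrow> emeasure H A = ennreal (1 - \<epsilon>) * emeasure H_o A + ennreal \<epsilon> * emeasure Hs A"
    using assms by (auto simp: contam_nbhd_def)
  have s: "space H = UNIV" "space H_o = UNIV" "space Hs = UNIV"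
    using sets_eq_imp_space_eq[OF H(1)] sets_eq_imp_space_eq[OF sets_H_o] H(2) sets_eq_imp_space_eq[of Hs borel]
    by (auto simp: distribution_def)
  have "emeasure (H_o :: (real \<times> 'a) measure) UNIV = 1"
  proof -
    interpret prob_space "H_o :: (real \<times> 'a) measure" by (rule prob_space_H_o)
    show ?thesis using emeasure_space_1 sets_eq_imp_space_eq[OF sets_H_o[where 'a='a]] by simp
  qed
  moreover have "emeasure Hs UNIV = 1"
    using H(2) prob_space.emeasure_space_1[of Hs] s by (simp add: distribution_def)
  ultimately have "emeasure H UNIV = 1"
    using H(3)[of UNIV] assms by (simp add: ennreal_plus[symmetric] del: ennreal_plus)
  then show ?thesis using H(1) s unfolding distribution_def by (auto intro!: prob_spaceI)
qed

lemma integral_contam: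
  fixes f :: "real \<times> 'a::euclidean_space \<Rightarrow> real"
  assumes "sets H = sets borel" "distribution Hs" "0 \<le> \<epsilon>" "\<epsilon> \<le> 1"
    and emH: "\<And>A. A \<in> sets borel \<Longrightarrow>
      emeasure H A = ennreal (1 - \<epsilon>) * emeasure H_o A + ennreal \<epsilon> * emeasure Hs A"
    and f: "f \<in> borel_measurable borel" "\<And>x. 0 \<le> f x" "\<And>x. f x \<le> 1"
  shows "(\<integral>x. f x \<partial>H) = (1 - \<epsilon>) * (\<integral>x. f x \<partial>H_o) + \<epsilon> * (\<integral>x. f x \<partial>Hs)"
proof -
  interpret O: prob_space "H_o :: (real \<times> 'a) measure" by (rule prob_space_H_o)
  interpret S: prob_space Hs using assms by (simp add: distribution_def)
  have s: "sets Hs = sets borel" using assms by (simp add: distribution_def)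
  have fm: "f \<in> borel_measurable H" "f \<in> borel_measurable H_o" "f \<in> borel_measurable Hs"
    using f(1) assms(1) s sets_H_o by (auto cong: measurable_cong_sets)
  have int: "integrable H_o f" "integrable Hs f"
    using f fm by (auto intro!: O.integrable_const_bound[where B=1] S.integrable_const_bound[where B=1])
  have "(\<integral>\<^sup>+x. ennreal (f x) \<partial>H) = ennreal (1 - \<epsilon>) * (\<integral>\<^sup>+x. ennreal (f x) \<partial>H_o) + ennreal \<epsilon> * (\<integral>\<^sup>+x. ennreal (f x) \<partial>Hs)"
    using assms(1) s fm by (intro nn_integral_mixture) (auto simp: emH)
  also have "\<dots> = ennreal ((1 - \<epsilon>) * (\<integral>x. f x \<partial>H_o) + \<epsilon> * (\<integral>x. f x \<partial>Hs))"
    using assms f int by (simp add: nn_integral_eq_integral ennreal_mult ennreal_plus integral_nonneg_AE)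
  finally show ?thesis
    using assms(3,4) fm f
    by (subst integral_eq_nn_integral)
       (auto intro!: enn2real_ennreal add_nonneg_nonneg mult_nonneg_nonneg integral_nonneg_AE simp del: ennreal_plus)
qed

lemma contam_point_mass:
  fixes z :: "real \<times> 'a::euclidean_space"
  assumes "0 \<le> \<epsilon>" "\<epsilon> \<le> 1"
  obtains H where "H \<in> contam_nbhd \<epsilon>"
    "\<And>f :: real \<times> 'a \<Rightarrow> real. f \<in> borel_measurable borel \<Longrightarrow> (\<And>x. 0 \<le> f x) \<Longrightarrow> (\<And>x. f x \<le> 1) \<Longrightarrow>
       (\<integral>x. f x \<partial>H) = (1 - \<epsilon>) * (\<integral>x. f x \<partial>H_o) + \<epsilon> * f z"
proof -
  let ?D = "return borel z"
  have D: "distribution ?D" by (auto simp: distribution_def intro: prob_space_return)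
  have "sets ?D = sets (H_o :: (real \<times> 'a) measure)" by simp
  then obtain H where H: "sets H = sets (H_o :: (real \<times> 'a) measure)"
    "\<And>A. A \<in> sets H_o \<Longrightarrow> emeasure H A = ennreal (1 - \<epsilon>) * emeasure H_o A + ennreal \<epsilon> * emeasure ?D A"
    using ex_mixture by metis
  show ?thesis
  proof
    show "H \<in> contam_nbhd \<epsilon>" unfolding contam_nbhd_def using H D by auto
    fix f :: "real \<times> 'a \<Rightarrow> real" assume f: "f \<in> borel_measurable borel" "\<And>x. 0 \<le> f x" "\<And>x. f x \<le> 1"
    show "(\<integral>x. f x \<partial>H) = (1 - \<epsilon>) * (\<integral>x. f x \<partial>H_o) + \<epsilon> * f z"
      using integral_contam[OF _ D assms _ f, of H] H f(1) by (simp add: integral_return)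
  qed
qed

section \<open>Analyticity of Gaussian scale averages\<close>

lemma integrable_exp_neg_square:
  fixes c :: real
  assumes "c > 0"
  shows "integrable lborel (\<lambda>u::real. exp (- c * u\<^sup>2))"
proof -
  define s where "s = 1 / sqrt (2 * c)"
  have s: "s > 0" "2 * s\<^sup>2 = 1 / c" using assms by (auto simp: s_def power_divide)
  have "integrable lborel (\<lambda>x. sqrt (2 * pi * s\<^sup>2) * normal_density 0 s x)"
    using s by simp
  moreover have "sqrt (2 * pi * s\<^sup>2) * normal_density 0 s x = exp (- c * x\<^sup>2)" for x
    using s assms by (simp add: normal_density_def field_simps)
  ultimately show ?thesis by simp
qed

text \<open>Expand \<open>exp (- z * u\<^sup>2)\<close> in powers of \<open>z - w\<close>. With
  \<open>d = norm (z - w) < w\<close>, the absolute values of the terms add up to at most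
  \<open>B * exp (- (w - d) * u\<^sup>2)\<close>, which is integrable, so sum and integral may be
  interchanged. The purpose is holomorphy of the transform on the disc.\<close>

lemma gaussian_transform_power_series:
  fixes r :: "real \<Rightarrow> real" and w :: real
  assumes r[measurable]: "r \<in> borel_measurable borel" and bnd: "\<And>u. \<bar>r u\<bar> \<le> B" and "w > 0"
  defines "a \<equiv> \<lambda>n. of_real (\<integral>u. r u * exp (- w * u\<^sup>2) * (- (u\<^sup>2)) ^ n / fact n \<partial>lborel) :: complex"
  assumes z: "z \<in> ball (of_real w) w"
  shows "(\<lambda>n. a n * (z - of_real w) ^ n) sums (\<integral>u. of_real (r u) * exp (- z * of_real (u\<^sup>2)) \<partial>lborel)"
proof -
  define d where "d = norm (z - of_real w)"
  have d: "0 \<le> d" "d < w" using z by (auto simp: d_def dist_norm norm_minus_commute)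
  define f where "f n u = of_real (r u * exp (- w * u\<^sup>2) * (- (u\<^sup>2)) ^ n / fact n) * (z - of_real w) ^ n"
    for n :: nat and u :: real
  have [measurable]: "f n \<in> borel_measurable lborel" for n
    unfolding f_def[abs_def] by measurable
  have nf: "norm (f n u) = \<bar>r u\<bar> * exp (- w * u\<^sup>2) * ((d * u\<^sup>2) ^ n /\<^sub>R fact n)" for n u
    by (simp add: f_def d_def norm_mult norm_power norm_divide power_mult_distrib abs_mult power_abs
        divide_inverse mult_ac del: of_real_mult of_real_divide)
  have nsums: "(\<lambda>n. norm (f n u)) sums (\<bar>r u\<bar> * exp (- (w - d) * u\<^sup>2))" for u
  proof -
    have "(\<lambda>n. \<bar>r u\<bar> * exp (- w * u\<^sup>2) * ((d * u\<^sup>2) ^ n /\<^sub>R fact n)) sums (\<bar>r u\<bar> * exp (- w * u\<^sup>2) * exp (d * u\<^sup>2))"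
      by (intro sums_mult exp_converges)
    then show ?thesis
      unfolding nf by (simp add: mult.assoc exp_add[symmetric] algebra_simps)
  qed
  have dom: "integrable lborel (\<lambda>u::real. B * exp (- (w - d) * u\<^sup>2))"
    using d by (intro integrable_mult_right integrable_exp_neg_square) auto
  have "B \<ge> 0" using bnd[of 0] by auto
  have part: "(\<Sum>n<N. norm (f n u)) \<le> B * exp (- (w - d) * u\<^sup>2)" for N u
  proof -
    have "(\<Sum>n<N. norm (f n u)) \<le> \<bar>r u\<bar> * exp (- (w - d) * u\<^sup>2)"
      using nsums[of u] by (metis sum_le_suminf sums_iff finite_lessThan norm_ge_zero)
    also have "\<dots> \<le> B * exp (- (w - d) * u\<^sup>2)" using bnd by (intro mult_right_mono) auto
    finally show ?thesis .
  qed
  have intf: "integrable lborel (f n)" for n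
  proof (rule Bochner_Integration.integrable_bound[OF dom])
    show "AE u in lborel. norm (f n u) \<le> norm (B * exp (- (w - d) * u\<^sup>2))"
    proof (rule AE_I2)
      fix u :: real
      have "norm (f n u) \<le> (\<Sum>n<Suc n. norm (f n u))" by (simp add: sum_nonneg)
      also have "\<dots> \<le> B * exp (- (w - d) * u\<^sup>2)" by (rule part)
      finally show "norm (f n u) \<le> norm (B * exp (- (w - d) * u\<^sup>2))" by simp
    qed
  qed measurable
  have "(\<lambda>n. integral\<^sup>L lborel (f n)) sums (\<integral>u. (\<Sum>n. f n u) \<partial>lborel)"
  proof (rule sums_integral)
    show "AE u in lborel. summable (\<lambda>n. norm (f n u))"
      using nsums sums_summable by blast
    show "summable (\<lambda>n. \<integral>u. norm (f n u) \<partial>lborel)"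
    proof (rule summableI_nonneg_bounded)
      fix N
      have "(\<Sum>n<N. \<integral>u. norm (f n u) \<partial>lborel) = (\<integral>u. (\<Sum>n<N. norm (f n u)) \<partial>lborel)"
        using intf by (subst Bochner_Integration.integral_sum) auto
      also have "\<dots> \<le> (\<integral>u. B * exp (- (w - d) * u\<^sup>2) \<partial>lborel)"
        using intf dom part by (intro integral_mono) auto
      finally show "(\<Sum>n<N. \<integral>u. norm (f n u) \<partial>lborel) \<le> (\<integral>u. B * exp (- (w - d) * u\<^sup>2) \<partial>lborel)" .
    qed auto
  qed (rule intf)
  moreover have "(\<Sum>n. f n u) = of_real (r u) * exp (- z * of_real (u\<^sup>2))" for u
  proof -
    let ?y = "- (z - of_real w) * of_real (u\<^sup>2)"
    have "(\<lambda>n. of_real (r u) * exp (- of_real w * of_real (u\<^sup>2)) * (?y ^ n /\<^sub>R fact n)) sums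
        (of_real (r u) * exp (- of_real w * of_real (u\<^sup>2)) * exp ?y)"
      by (intro sums_mult exp_converges)
    moreover have "of_real (r u) * exp (- of_real w * of_real (u\<^sup>2)) * (?y ^ n /\<^sub>R fact n) = f n u" for n
    proof -
      have "?y = of_real (- (u\<^sup>2)) * (z - of_real w)" by (simp add: algebra_simps)
      then have "?y ^ n = of_real ((- (u\<^sup>2)) ^ n) * (z - of_real w) ^ n"
        by (simp only: power_mult_distrib of_real_power)
      then show ?thesis
        by (simp add: f_def exp_of_real[symmetric] scaleR_conv_of_real field_simps)
    qed
    ultimately show ?thesis by (simp add: sums_iff mult.assoc exp_add[symmetric] algebra_simps)
  qed
  moreover have "integral\<^sup>L lborel (f n) = a n * (z - of_real w) ^ n" for n
    unfolding f_def[abs_def] a_def by (subst integral_mult_left_zero) (simp only: integral_complex_of_real)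
  ultimately show ?thesis by simp
qed

text \<open>
  As a function of \<open>s\<^sup>2 / 2\<close>, a Gaussian scale average is a Laplace transform up to the factor \<open>s\<close>,
  hence analytic; so a logarithmic form on some interval would persist down to \<open>0\<close>,
  where it is unbounded.
\<close>

lemma gaussian_scale_not_log:
  fixes r :: "real \<Rightarrow> real"
  assumes r[measurable]: "r \<in> borel_measurable borel" and bnd: "\<And>u. \<bar>r u\<bar> \<le> B"
    and "0 < x" "x < y" "k \<noteq> 0"
    and log: "\<And>s. x < s \<Longrightarrow> s < y \<Longrightarrow> (\<integral>z. r (z / s) \<partial>std_normal_distribution) = A - k * ln s"
  shows False
proof -
  define g where "g s = (\<integral>z. r (z / s) \<partial>std_normal_distribution)" for s
  define F where "F z = (\<integral>u. of_real (r u) * exp (- z * of_real (u\<^sup>2)) \<partial>lborel)" for z :: complex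
  have gF: "F (of_real (s\<^sup>2 / 2)) = of_real (sqrt (2 * pi) * g s / s)" if "s > 0" for s
  proof -
    have "g s = (\<integral>z. std_normal_density z * r (z / s) \<partial>lborel)"
      unfolding g_def by (subst integral_density) auto
    also have "\<dots> = s * (\<integral>u. std_normal_density (s * u) * r u \<partial>lborel)"
      using that by (subst lborel_integral_real_affine[of s _ 0]) auto
    also have "(\<integral>u. std_normal_density (s * u) * r u \<partial>lborel) = (\<integral>u. r u * exp (- (s\<^sup>2 / 2) * u\<^sup>2) / sqrt (2 * pi) \<partial>lborel)"
      by (intro Bochner_Integration.integral_cong) (auto simp: std_normal_density_def power_mult_distrib)
    also have "\<dots> = (\<integral>u. r u * exp (- (s\<^sup>2 / 2) * u\<^sup>2) \<partial>lborel) / sqrt (2 * pi)"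
      by simp
    finally have "(\<integral>u. r u * exp (- (s\<^sup>2 / 2) * u\<^sup>2) \<partial>lborel) = sqrt (2 * pi) * g s / s"
      using that by (simp add: field_simps)
    moreover have "F (of_real (s\<^sup>2 / 2)) = of_real (\<integral>u. r u * exp (- (s\<^sup>2 / 2) * u\<^sup>2) \<partial>lborel)"
      unfolding F_def integral_complex_of_real[symmetric] by (simp add: exp_of_real[symmetric])
    ultimately show ?thesis by simp
  qed
  have g_bnd: "\<bar>g s\<bar> \<le> B" for s
  proof -
    interpret N: prob_space std_normal_distribution by (rule prob_space_normal_density) simp
    have i: "integrable std_normal_distribution (\<lambda>z. r (z / s))"
      by (rule N.integrable_const_bound[where B=B]) (use bnd in auto)
    have "\<bar>g s\<bar> \<le> (\<integral>z. \<bar>r (z / s)\<bar> \<partial>std_normal_distribution)"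
      unfolding g_def using integral_norm_bound[of std_normal_distribution "\<lambda>z. r (z / s)"] by simp
    also have "\<dots> \<le> (\<integral>z. B \<partial>std_normal_distribution)"
      using i bnd by (intro integral_mono) auto
    finally show ?thesis using N.prob_space by simp
  qed
  define s0 where "s0 = (x + y) / 2"
  have s0: "x < s0" "s0 < y" "s0 > 0" using assms by (auto simp: s0_def)
  define w where "w = s0\<^sup>2 / 2"
  have w: "w > 0" using s0 by (simp add: w_def)
  \<comment> \<open>The disc touches 0, so it contains \<open>s\<^sup>2 / 2\<close> for every
    \<open>s\<close> in (0, \<open>s0\<close>); this is how the logarithmic form reaches down to
    arbitrarily small scales.\<close>
  define S where "S = ball (complex_of_real w) w"
  have holF: "F holomorphic_on S"
    unfolding S_def F_def
    by (rule power_series_holomorphic[OF gaussian_transform_power_series[OF r bnd w]])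
  \<comment> \<open>The logarithmic form in the variable \<open>z = s\<^sup>2 / 2\<close>: here
    \<open>Ln (2 * z) / 2\<close> stands for \<open>ln s\<close>, and the last factor for
    \<open>1 / s\<close>.\<close>
  define G where "G z = of_real (sqrt (2 * pi)) * (of_real A - of_real k * (Ln (2 * z) / 2)) * exp (- (Ln (2 * z) / 2))" for z
  have pos: "Re z > 0" if "z \<in> S" for z
  proof -
    have "\<bar>Re (of_real w - z)\<bar> < w"
      using that abs_Re_le_cmod[of "of_real w - z"] by (simp add: S_def dist_norm)
    then show ?thesis by simp
  qed
  have nonpos: "2 * z \<notin> \<real>\<^sub>\<le>\<^sub>0" if "z \<in> S" for z
    using pos[OF that] by (auto simp: complex_nonpos_Reals_iff)
  have holG: "G holomorphic_on S"
    unfolding G_def by (intro holomorphic_intros) (use nonpos in auto)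
  have Geq: "G (of_real (s\<^sup>2 / 2)) = of_real (sqrt (2 * pi) * (A - k * ln s) / s)" if "s > 0" for s
  proof -
    have "Ln (2 * of_real (s\<^sup>2 / 2)) / 2 = of_real (ln s)"
      using that Ln_of_real[of "s\<^sup>2"] by (simp add: ln_realpow flip: of_real_power)
    moreover have "exp (- complex_of_real (ln s)) = of_real (1 / s)"
      using that by (metis exp_of_real exp_minus exp_ln of_real_minus inverse_eq_divide)
    ultimately show ?thesis unfolding G_def by simp
  qed
  define U where "U = (\<lambda>s. complex_of_real (s\<^sup>2 / 2)) ` ({x<..<y} \<inter> {s. complex_of_real (s\<^sup>2 / 2) \<in> S})"
  have w_in: "complex_of_real w \<in> S" using w by (simp add: S_def)
  have limpt: "complex_of_real w islimpt U"
  proof -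
    let ?h = "\<lambda>s. complex_of_real (s\<^sup>2 / 2)"
    have h: "(?h \<longlongrightarrow> ?h s0) (at s0)" by (intro tendsto_intros) auto
    have ev1: "\<forall>\<^sub>F s in at s0. s \<in> {x<..<y}"
      using s0 eventually_at_in_open[of "{x<..<y}" s0] by (auto elim: eventually_mono)
    have ev2: "\<forall>\<^sub>F s in at s0. ?h s \<in> S"
      using topological_tendstoD[OF h, of S] w_in by (auto simp: S_def w_def)
    have ev3: "\<forall>\<^sub>F s in at s0. s \<noteq> s0" by (simp add: eventually_at_filter)
    show ?thesis
      unfolding islimpt_approachable
    proof (intro allI impI)
      fix e :: real assume "e > 0"
      have ev4: "\<forall>\<^sub>F s in at s0. dist (?h s) (?h s0) < e"
        using tendstoD[OF h \<open>e > 0\<close>] .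
      have "\<forall>\<^sub>F s in at s0. s \<in> {x<..<y} \<and> ?h s \<in> S \<and> s \<noteq> s0 \<and> dist (?h s) (?h s0) < e"
        using ev1 ev2 ev3 ev4 by eventually_elim blast
      then obtain s where s: "s \<in> {x<..<y}" "?h s \<in> S" "s \<noteq> s0" "dist (?h s) (?h s0) < e"
        using eventually_happens'[of "at s0"] by auto
      have "s\<^sup>2 \<noteq> s0\<^sup>2" using s s0 assms by (auto simp: power2_eq_iff)
      then have "?h s \<noteq> ?h s0" by (metis of_real_eq_iff divide_cancel_right zero_neq_numeral)
      then show "\<exists>x'\<in>U. x' \<noteq> complex_of_real w \<and> dist x' (complex_of_real w) < e"
        using s unfolding U_def w_def by (intro bexI[of _ "?h s"]) auto
    qed
  qed
  have eq: "F z = G z" if "z \<in> S" for z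
  proof -
    have "F z - G z = 0"
    proof (rule analytic_continuation[of "\<lambda>z. F z - G z" S U "complex_of_real w" z])
      show "(\<lambda>z. F z - G z) holomorphic_on S" using holF holG by (intro holomorphic_intros)
      show "F z - G z = 0" if zU: "z \<in> U" for z
      proof -
        obtain s where s: "x < s" "s < y" "z = of_real (s\<^sup>2 / 2)" using zU by (auto simp: U_def)
        then have "s > 0" using assms by simp
        then have "F z = G z" unfolding s(3) gF[OF \<open>s > 0\<close>] Geq[OF \<open>s > 0\<close>] using log[OF s(1,2)] by (simp add: g_def)
        then show ?thesis by simp
      qed
    qed (use w_in limpt that in \<open>auto simp: S_def U_def\<close>)
    then show ?thesis by simp
  qed
  have glog: "g s = A - k * ln s" if s: "0 < s" "s < s0" for s
  proof -
    have "s\<^sup>2 < s0\<^sup>2" using s by (simp add: power_strict_mono)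
    then have "complex_of_real (s\<^sup>2 / 2) \<in> S"
      using s unfolding S_def w_def mem_ball dist_of_real by (simp add: dist_real_def)
    then have "complex_of_real (sqrt (2 * pi) * g s / s) = of_real (sqrt (2 * pi) * (A - k * ln s) / s)"
      using eq gF[OF s(1)] Geq[OF s(1)] by metis
    then have "sqrt (2 * pi) * g s / s = sqrt (2 * pi) * (A - k * ln s) / s"
      using of_real_eq_iff by blast
    then show ?thesis using s by simp
  qed
  \<comment> \<open>Large enough that \<open>exp (- M)\<close> lies below \<open>s0\<close> while
    \<open>\<bar>k\<bar> * M\<close> exceeds \<open>\<bar>A\<bar> + B\<close>, against the bound on
    \<open>g\<close>.\<close>
  define M where "M = \<bar>ln s0\<bar> + (\<bar>A\<bar> + B) / \<bar>k\<bar> + 1"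
  have "B \<ge> 0" using bnd[of 0] by auto
  have "0 \<le> (\<bar>A\<bar> + B) / \<bar>k\<bar>" using \<open>B \<ge> 0\<close> by simp
  then have "- M < ln s0" "M > (\<bar>A\<bar> + B) / \<bar>k\<bar>" unfolding M_def by linarith+
  have "exp (- M) < s0" using \<open>- M < ln s0\<close> s0 by (metis exp_less_mono exp_ln)
  then have "g (exp (- M)) = A + k * M" using glog[of "exp (- M)"] by simp
  then have "\<bar>k * M\<bar> \<le> \<bar>A\<bar> + B" using g_bnd[of "exp (- M)"] by linarith
  moreover have "\<bar>k * M\<bar> > \<bar>A\<bar> + B"
  proof -
    have "M > 0" using \<open>M > (\<bar>A\<bar> + B) / \<bar>k\<bar>\<close> \<open>0 \<le> (\<bar>A\<bar> + B) / \<bar>k\<bar>\<close> by linarith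
    then show ?thesis
      using \<open>M > (\<bar>A\<bar> + B) / \<bar>k\<bar>\<close> \<open>k \<noteq> 0\<close> by (simp add: abs_mult field_simps)
  qed
  ultimately show False by simp
qed

section \<open>Averages of \<open>\<rho>\<close>\<close>

lemma prob_space_std_normal: "prob_space std_normal_distribution"
  by (rule prob_space_normal_density) simp

locale rho_function =
  fixes \<rho> :: "real \<Rightarrow> real"
  assumes A3: "cond_A3 \<rho>"
begin

abbreviation "g \<equiv> g_fun \<rho>"

lemma rho_nonneg [simp]: "0 \<le> \<rho> u"
  and rho_minus [simp]: "\<rho> (- u) = \<rho> u"
  and rho_0 [simp]: "\<rho> 0 = 0"
  and rho_at_top: "(\<rho> \<longlongrightarrow> 1) at_top"
  using A3 by (auto simp: cond_A3_def)

lemma rho_abs: "\<rho> \<bar>u\<bar> = \<rho> u"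
  by (simp add: abs_if)

lemma rho_mono: "\<bar>x\<bar> \<le> \<bar>y\<bar> \<Longrightarrow> \<rho> x \<le> \<rho> y"
proof -
  assume "\<bar>x\<bar> \<le> \<bar>y\<bar>"
  moreover have "mono_on {0..} \<rho>" using A3 by (simp add: cond_A3_def)
  ultimately have "\<rho> \<bar>x\<bar> \<le> \<rho> \<bar>y\<bar>" by (simp add: mono_on_def)
  then show ?thesis unfolding rho_abs .
qed

lemma rho_le_1 [simp]: "\<rho> u \<le> 1"
proof (rule tendsto_lowerbound[OF rho_at_top])
  show "\<forall>\<^sub>F x in at_top. \<rho> u \<le> \<rho> x"
    using eventually_ge_at_top[of "\<bar>u\<bar>"] by eventually_elim (auto intro!: rho_mono)
qed simp

text \<open>Monotonicity on the half-line gives measurability of the function extended by its value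
  at 0; composing with the absolute value recovers \<rho>.\<close>

lemma rho_measurable [measurable]: "\<rho> \<in> borel_measurable borel"
proof -
  have "mono (\<lambda>x. \<rho> (max x 0))" by (auto simp: mono_def intro!: rho_mono)
  then have [measurable]: "(\<lambda>x. \<rho> (max x 0)) \<in> borel_measurable borel"
    by (rule borel_measurable_mono)
  have "(\<lambda>x. (\<lambda>x. \<rho> (max x 0)) \<bar>x\<bar>) \<in> borel_measurable borel" by measurable
  then show ?thesis by (simp add: rho_abs)
qed

lemma rho_near_1:
  assumes "\<delta> < 1"
  obtains K where "K > 0" "\<rho> K > \<delta>"
proof -
  have "\<forall>\<^sub>F x in at_top. \<delta> < \<rho> x" using order_tendstoD(1)[OF rho_at_top assms] .
  then have "\<forall>\<^sub>F x in at_top. \<delta> < \<rho> x \<and> x > 0" using eventually_gt_at_top by (rule eventually_conj)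
  then show ?thesis using that by (auto dest!: eventually_happens)
qed

lemma integrable_rho:
  assumes "prob_space M" "f \<in> borel_measurable M"
  shows "integrable M (\<lambda>x. \<rho> (f x))"
proof -
  interpret prob_space M by fact
  show ?thesis using assms(2) by (intro integrable_const_bound[where B=1]) auto
qed

lemma integrable_rho_normal [simp]: "integrable std_normal_distribution (\<lambda>z. \<rho> (z / s))"
  by (rule integrable_rho[OF prob_space_std_normal]) simp

lemma g_nonneg: "0 \<le> g s"
  unfolding g_fun_def by (rule integral_nonneg_AE) simp

lemma g_le_1: "g s \<le> 1"
proof -
  interpret N: prob_space std_normal_distribution by (rule prob_space_std_normal)
  have "g s \<le> (\<integral>z. 1 \<partial>std_normal_distribution)"
    unfolding g_fun_def by (intro integral_mono) auto
  then show ?thesis using N.prob_space by simp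
qed

lemma g_antimono: "0 < s \<Longrightarrow> s \<le> t \<Longrightarrow> g t \<le> g s"
  unfolding g_fun_def
  by (intro integral_mono integrable_rho_normal rho_mono) (simp add: frac_le)

text \<open>Along the scales \<open>1 / (n + 1)\<close> the integrand tends to 1 at every nonzero
  point, so \<open>g\<close> tends to 1 by dominated convergence.\<close>

lemma g_near_0:
  assumes "u < 1" "0 < e"
  obtains s where "0 < s" "s < e" "u < g s"
proof -
  interpret N: prob_space std_normal_distribution by (rule prob_space_std_normal)
  have "(\<lambda>n. \<integral>z. \<rho> (z / (1 / real (Suc n))) \<partial>std_normal_distribution) \<longlonglongrightarrow> (\<integral>z. 1 \<partial>std_normal_distribution)"
  proof (rule integral_dominated_convergence[where w="\<lambda>_. 1"])
    have "AE z in lborel. z \<noteq> (0::real)" by (rule AE_lborel_singleton)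
    then have "AE z in std_normal_distribution. z \<noteq> 0" by (subst AE_density) auto
    then show "AE z in std_normal_distribution. (\<lambda>n. \<rho> (z / (1 / real (Suc n)))) \<longlonglongrightarrow> 1"
    proof eventually_elim
      fix z :: real assume "z \<noteq> 0"
      have "filterlim (\<lambda>n. \<bar>z\<bar> * real (Suc n)) at_top sequentially"
        using \<open>z \<noteq> 0\<close> 
        by (intro filterlim_tendsto_pos_mult_at_top[OF tendsto_const]
             filterlim_compose[OF filterlim_real_sequentially filterlim_Suc]) auto
      then have "(\<lambda>n. \<rho> (\<bar>z\<bar> * real (Suc n))) \<longlonglongrightarrow> 1"
        by (rule filterlim_compose[OF rho_at_top])
      moreover have "\<rho> (\<bar>z\<bar> * real (Suc n)) = \<rho> (z / (1 / real (Suc n)))" for n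
        by (intro antisym rho_mono) (auto simp: abs_mult)
      ultimately show "(\<lambda>n. \<rho> (z / (1 / real (Suc n)))) \<longlonglongrightarrow> 1" by simp
    qed
  qed auto
  then have lim: "(\<lambda>n. g (1 / real (Suc n))) \<longlonglongrightarrow> 1"
    using N.prob_space by (simp add: g_fun_def)
  have "\<forall>\<^sub>F n in sequentially. u < g (1 / real (Suc n))" using order_tendstoD(1)[OF lim assms(1)] .
  moreover have "\<forall>\<^sub>F n in sequentially. 1 / real (Suc n) < e"
    using order_tendstoD(2)[OF LIMSEQ_inverse_real_of_nat assms(2)] by (simp add: divide_inverse)
  ultimately have "\<forall>\<^sub>F n in sequentially. u < g (1 / real (Suc n)) \<and> 1 / real (Suc n) < e"
    by (rule eventually_conj)
  then obtain n where "u < g (1 / real (Suc n))" "1 / real (Suc n) < e"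
    by (auto dest!: eventually_happens)
  then show ?thesis using that[of "1 / real (Suc n)"] by simp
qed

text \<open>Intermediate values between \<open>t\<close> and a small scale from
  \<open>g_near_0\<close>. The witness \<open>t\<close> is part of the hypotheses because
  \<open>g\<close> need not come close to 0: a jump of \<rho> at 0 keeps it away.\<close>

lemma g_onto:
  assumes cont: "continuous_on {0<..} g" and "0 < t" "g t \<le> u" "u < 1"
  obtains s where "0 < s" "s \<le> t" "g s = u"
proof -
  obtain s0 where s0: "0 < s0" "s0 < t" "u < g s0" using g_near_0[OF assms(4,2)] .
  have c: "continuous_on {s0..t} g" using s0 by (intro continuous_on_subset[OF cont]) auto
  obtain s where s: "s0 \<le> s" "s \<le> t" "g s = u"
    using IVT2'[OF assms(3) less_imp_le[OF s0(3)] less_imp_le[OF s0(2)] c] by blast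
  have "0 < s" using s(1) s0(1) by linarith
  then show ?thesis using that s by blast
qed

text \<open>
  By convexity a level interval of \<open>g\<close> would extend to infinity; letting the scale tend to
  infinity, \<open>\<rho>\<close> would then be constant away from \<open>0\<close>, hence \<open>g = 1\<close>.
\<close>

lemma g_strict_antimono:
  assumes conv: "convex_on {0<..} g" and s1: "0 < s1" "g s1 < 1" and st: "0 < s" "s < t"
  shows "g t < g s"
proof (rule ccontr)
  assume "\<not> g t < g s"
  then have eq: "g t = g s" using g_antimono[of s t] st by simp
  have flat: "g u = g s" if "t < u" for u
  proof -
    have "g t \<le> (g u - g s) / (u - s) * (t - s) + g s"
    proof (rule convex_onD_Icc')
      show "convex_on {s..u} g" using st by (intro convex_on_subset[OF conv]) auto
    qed (use st that in auto)
    then have "0 \<le> (g u - g s) / (u - s) * (t - s)" using eq by simp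
    then have "g s \<le> g u" using st that by (simp add: zero_le_mult_iff zero_le_divide_iff)
    then show ?thesis using g_antimono[of s u] st that by simp
  qed
  have "AE z in std_normal_distribution. \<rho> (z / s) = \<rho> (z / (t * real (Suc k)))" for k
  proof -
    have "t \<le> t * real (Suc k)" using st by simp
    have "g (t * real (Suc k)) = g s"
    proof (cases "k = 0")
      case True then show ?thesis using eq by simp
    next
      case False then show ?thesis using st by (intro flat) auto
    qed
    moreover have "s \<le> t * real (Suc k)" using st \<open>t \<le> t * real (Suc k)\<close> by linarith
    ultimately have "(\<integral>z. \<rho> (z / s) - \<rho> (z / (t * real (Suc k))) \<partial>std_normal_distribution) = 0"
      by (subst Bochner_Integration.integral_diff) (auto simp: g_fun_def)
    moreover have "0 \<le> \<rho> (z / s) - \<rho> (z / (t * real (Suc k)))" for z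
      using rho_mono[of "z / (t * real (Suc k))" "z / s"] st \<open>s \<le> t * real (Suc k)\<close>
      by (simp add: frac_le abs_mult)
    ultimately show ?thesis
      by (subst (asm) integral_nonneg_eq_0_iff_AE) auto
  qed
  then have "AE z in std_normal_distribution. \<forall>k. \<rho> (z / s) = \<rho> (z / (t * real (Suc k)))"
    by (simp add: AE_all_countable)
  then have ae: "AE z in lborel. \<forall>k. \<rho> (z / s) = \<rho> (z / (t * real (Suc k)))"
    by (subst (asm) AE_density) (simp_all add: normal_density_pos)
  \<comment> \<open>The exceptional null set cannot contain an interval of length 1, so a good point
    exists beyond every bound.\<close>
  have big: "\<exists>z>m. \<forall>k. \<rho> (z / s) = \<rho> (z / (t * real (Suc k)))" for m :: real
  proof (rule ccontr)
    assume "\<not> ?thesis"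
    with ae have "AE z in lborel. z \<notin> {m<..<m+1}" by (auto elim!: eventually_mono)
    then have "emeasure lborel {m<..<m+1} = 0"
      by (subst (asm) AE_iff_measurable[of "{m<..<m+1}"]) auto
    moreover have "emeasure lborel {m<..<m+1} = 1" by simp
    ultimately show False by simp
  qed
  \<comment> \<open>One large good point \<open>z\<close> serves both ends: \<open>z / s\<close>
    exceeds \<open>K\<close>, while \<open>z / (t * (k + 1))\<close> drops below \<open>x\<close>
    for large \<open>k\<close>. Equality of the two values of \<rho> then contradicts the choice of
    \<open>K\<close>.\<close>
  have one: "\<rho> x = 1" if "x > 0" for x
  proof (rule ccontr)
    assume "\<rho> x \<noteq> 1"
    then have "\<rho> x < 1" using rho_le_1[of x] by linarith
    then obtain K where K: "K > 0" "\<rho> K > \<rho> x" using rho_near_1 by blast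
    obtain z where z: "z > K * s" "\<And>k. \<rho> (z / s) = \<rho> (z / (t * real (Suc k)))"
      using big[of "K * s"] by auto
    then have "z > 0" using K st by (smt (verit) mult_pos_pos)
    have "K \<le> z / s" using z st by (simp add: field_simps)
    then have "\<rho> K \<le> \<rho> (z / s)" using K by (intro rho_mono) linarith
    obtain k :: nat where k: "z / (t * x) \<le> real k" using real_arch_simple by blast
    have tx: "0 < t * x" using st that by simp
    have "z \<le> real k * (t * x)" using k by (simp only: pos_divide_le_eq[OF tx])
    also have "\<dots> \<le> real (Suc k) * (t * x)" using tx by (intro mult_right_mono) auto
    also have "\<dots> = x * (t * real (Suc k))" by simp
    finally have "z / (t * real (Suc k)) \<le> x"
      using st by (subst pos_divide_le_eq) (simp_all del: of_nat_Suc)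
    then have "\<rho> (z / (t * real (Suc k))) \<le> \<rho> x" using \<open>z > 0\<close> st that by (intro rho_mono) auto
    then show False using z(2)[of k] K \<open>\<rho> K \<le> \<rho> (z / s)\<close> by linarith
  qed
  interpret N: prob_space std_normal_distribution by (rule prob_space_std_normal)
  have "AE z in lborel. z \<noteq> (0::real)" by (rule AE_lborel_singleton)
  then have "AE z in std_normal_distribution. z \<noteq> 0" by (subst AE_density) auto
  then have "AE z in std_normal_distribution. \<rho> (z / s1) = 1"
  proof eventually_elim
    fix z :: real assume "z \<noteq> 0"
    then show "\<rho> (z / s1) = 1" using one[of "\<bar>z / s1\<bar>"] s1 rho_abs[of "z / s1"] by simp
  qed
  then have "g s1 = (\<integral>z. 1 \<partial>std_normal_distribution)"
    unfolding g_fun_def by (intro integral_cong_AE) auto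
  then show False using s1 N.prob_space by simp
qed

section \<open>Mean losses under the central model and under contamination\<close>

lemma mean_rho_H_o:
  fixes \<theta> :: "'a::euclidean_space"
  shows "mean_rho \<rho> H_o (\<alpha>, \<theta>, \<sigma>) =
    (\<integral>z. \<rho> ((sqrt (1 + (norm \<theta>)\<^sup>2) * z - \<alpha>) / \<sigma>) \<partial>std_normal_distribution)"
proof -
  \<comment> \<open>The residual without intercept is the projection onto \<open>v\<close>, whose
    norm is the factor \<open>sqrt (1 + (norm \<theta>)\<^sup>2)\<close> by which scales are
    standardized.\<close>
  define v where "v = (1::real, - \<theta>)"
  have "fst z - \<alpha> - snd z \<bullet> \<theta> = z \<bullet> v - \<alpha>" for z :: "real \<times> 'a"
    by (cases z) (simp add: v_def)
  then have "mean_rho \<rho> H_o (\<alpha>, \<theta>, \<sigma>) = (\<integral>z. (\<lambda>x. \<rho> ((x - \<alpha>) / \<sigma>)) (z \<bullet> v) \<partial>std_normal_vec)"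
    by (simp only: mean_rho_def H_o_def prod.case)
  also have "\<dots> = (\<integral>z. \<rho> ((norm v * z - \<alpha>) / \<sigma>) \<partial>std_normal_distribution)"
    by (rule integral_std_normal_vec_inner) measurable
  finally show ?thesis by (simp add: v_def norm_Pair)
qed

lemma mean_rho_H_o_0: "mean_rho \<rho> H_o (0, \<theta>, \<sigma>) = g (\<sigma> / sqrt (1 + (norm \<theta>)\<^sup>2))"
  by (simp add: mean_rho_H_o g_fun_def mult.commute)

text \<open>The Anderson inequality with shift \<open>\<alpha> / \<tau>\<close>: among all
  intercepts, 0 gives the smallest mean loss at the model.\<close>

lemma mean_rho_H_o_ge:
  assumes "\<sigma> > 0"
  shows "g (\<sigma> / sqrt (1 + (norm \<theta>)\<^sup>2)) \<le> mean_rho \<rho> H_o (\<alpha>, \<theta>, \<sigma>)"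
proof -
  define \<tau> where "\<tau> = sqrt (1 + (norm \<theta>)\<^sup>2)"
  have "\<tau> > 0" unfolding \<tau>_def by (simp add: add_pos_nonneg)
  have "(\<integral>x. \<rho> (x * \<tau> / \<sigma>) \<partial>std_normal_distribution) \<le>
      (\<integral>x. \<rho> ((x - \<alpha> / \<tau>) * \<tau> / \<sigma>) \<partial>std_normal_distribution)"
    using \<open>\<tau> > 0\<close> assms
    by (intro anderson_real[where r="\<lambda>x. \<rho> (x * \<tau> / \<sigma>)" and B=1])
       (auto intro!: rho_mono divide_right_mono mult_right_mono simp: abs_mult)
  moreover have "(x - \<alpha> / \<tau>) * \<tau> / \<sigma> = (\<tau> * x - \<alpha>) / \<sigma>" for x
  proof -
    have "(x - \<alpha> / \<tau>) * \<tau> = \<tau> * x - \<alpha>" using \<open>\<tau> > 0\<close> by (simp add: field_simps)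
    then show ?thesis by simp
  qed
  ultimately show ?thesis unfolding mean_rho_H_o \<tau>_def[symmetric] g_fun_def by simp
qed

text \<open>The assumptions bound \<open>sqrt (1 + (norm \<theta>)\<^sup>2)\<close> by
  \<open>S / \<kappa>\<close>. An intercept beyond \<open>n\<close> therefore leaves residuals of
  size at least \<open>n / 2\<close> on the event that \<open>\<bar>z\<bar>\<close> is at most
  \<open>n * \<kappa> / (2 * S)\<close>, whose probability tends to 1.\<close>

lemma intercept_bounded:
  assumes "\<delta> < 1" "\<kappa> > 0" "S > 0"
  obtains A where "\<And>\<alpha> (\<theta> :: 'a::euclidean_space) \<sigma>. 0 < \<sigma> \<Longrightarrow> \<sigma> \<le> S \<Longrightarrow>
    \<kappa> \<le> \<sigma> / sqrt (1 + (norm \<theta>)\<^sup>2) \<Longrightarrow> mean_rho \<rho> H_o (\<alpha>, \<theta>, \<sigma>) \<le> \<delta> \<Longrightarrow> \<bar>\<alpha>\<bar> \<le> A"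
proof -
  interpret N: prob_space std_normal_distribution by (rule prob_space_std_normal)
  \<comment> \<open>A lower bound for the integrand that does not depend on the parameters; its mean
    tends to 1 and so passes \<delta>.\<close>
  define q where "q n z = \<rho> (real n / (2 * S)) * indicator {z. \<bar>z\<bar> \<le> real n * \<kappa> / (2 * S)} z"
    for n :: nat and z :: real
  have [measurable]: "q n \<in> borel_measurable borel" for n unfolding q_def[abs_def] by measurable
  have q_bnd: "\<bar>q n z\<bar> \<le> 1" for n z by (auto simp: q_def indicator_def)
  have "(\<lambda>n. \<integral>z. q n z \<partial>std_normal_distribution) \<longlonglongrightarrow> (\<integral>z. 1 \<partial>std_normal_distribution)"
  proof (rule integral_dominated_convergence[where w="\<lambda>_. 1"])
    show "AE z in std_normal_distribution. (\<lambda>n. q n z) \<longlonglongrightarrow> 1"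
    proof (rule AE_I2)
      fix z :: real
      have "filterlim (\<lambda>n. 1 / (2 * S) * real n) at_top sequentially"
        using assms by (intro filterlim_tendsto_pos_mult_at_top[OF tendsto_const _ filterlim_real_sequentially]) auto
      then have "(\<lambda>n. \<rho> (real n / (2 * S))) \<longlonglongrightarrow> 1"
        using filterlim_compose[OF rho_at_top, of "\<lambda>n. 1 / (2 * S) * real n" sequentially] by simp
      moreover have "\<forall>\<^sub>F n in sequentially. \<rho> (real n / (2 * S)) = q n z"
      proof -
        have "\<forall>\<^sub>F n in sequentially. \<bar>z\<bar> * (2 * S) / \<kappa> \<le> real n"
          using filterlim_real_sequentially unfolding filterlim_at_top by blast
        then show ?thesis
        proof eventually_elim
          fix n assume "\<bar>z\<bar> * (2 * S) / \<kappa> \<le> real n"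
          then show "\<rho> (real n / (2 * S)) = q n z"
            using assms by (simp add: q_def field_simps)
        qed
      qed
      ultimately show "(\<lambda>n. q n z) \<longlonglongrightarrow> 1" by (rule Lim_transform_eventually)
    qed
  qed (use q_bnd in auto)
  then have "\<forall>\<^sub>F n in sequentially. \<delta> < (\<integral>z. q n z \<partial>std_normal_distribution)"
    using order_tendstoD(1) assms(1) N.prob_space by simp
  then obtain n where n: "\<delta> < (\<integral>z. q n z \<partial>std_normal_distribution)"
    by (auto dest!: eventually_happens)
  have "\<bar>\<alpha>\<bar> \<le> real n" if \<sigma>: "0 < \<sigma>" "\<sigma> \<le> S" and \<kappa>: "\<kappa> \<le> \<sigma> / sqrt (1 + (norm \<theta>)\<^sup>2)"
    and le: "mean_rho \<rho> H_o (\<alpha>, \<theta>, \<sigma>) \<le> \<delta>" for \<alpha> and \<theta> :: 'a and \<sigma>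
  proof (rule ccontr)
    assume "\<not> \<bar>\<alpha>\<bar> \<le> real n"
    define \<tau> where "\<tau> = sqrt (1 + (norm \<theta>)\<^sup>2)"
    have "\<tau> > 0" unfolding \<tau>_def by (simp add: add_pos_nonneg)
    then have \<tau>: "\<tau> * \<kappa> \<le> S" using \<kappa> \<sigma> by (simp add: \<tau>_def[symmetric] field_simps)
    have "q n z \<le> \<rho> ((\<tau> * z - \<alpha>) / \<sigma>)" for z
    proof (cases "\<bar>z\<bar> \<le> real n * \<kappa> / (2 * S)")
      case True
      have "\<tau> * \<bar>z\<bar> \<le> \<tau> * (real n * \<kappa> / (2 * S))" using True \<open>\<tau> > 0\<close> by (intro mult_left_mono) auto
      also have "\<dots> = (\<tau> * \<kappa>) * (real n / (2 * S))" by simp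
      also have "\<dots> \<le> S * (real n / (2 * S))" using \<tau> assms by (intro mult_right_mono) auto
      also have "\<dots> = real n / 2" using assms by simp
      finally have "\<bar>\<tau> * z\<bar> \<le> real n / 2" using \<open>\<tau> > 0\<close> by (simp add: abs_mult)
      then have "real n / 2 \<le> \<bar>\<tau> * z - \<alpha>\<bar>" using \<open>\<not> \<bar>\<alpha>\<bar> \<le> real n\<close> by linarith
      then have "(real n / 2) / S \<le> \<bar>\<tau> * z - \<alpha>\<bar> / \<sigma>" using \<sigma> by (intro frac_le) auto
      then have "\<rho> (real n / (2 * S)) \<le> \<rho> ((\<tau> * z - \<alpha>) / \<sigma>)"
        using \<sigma> assms by (intro rho_mono) (simp add: abs_mult)
      then show ?thesis using True by (simp add: q_def)
    qed (simp add: q_def)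
    then have "(\<integral>z. q n z \<partial>std_normal_distribution) \<le> mean_rho \<rho> H_o (\<alpha>, \<theta>, \<sigma>)"
      unfolding mean_rho_H_o \<tau>_def[symmetric]
      by (intro integral_mono integrable_rho[OF prob_space_std_normal] N.integrable_const_bound[where B=1])
         (use q_bnd in auto)
    then show False using n le by linarith
  qed
  then show ?thesis using that by blast
qed

lemma mean_rho_measurable:
  "(\<lambda>z :: real \<times> 'a::euclidean_space. \<rho> ((fst z - \<alpha> - snd z \<bullet> \<theta>) / \<sigma>)) \<in> borel_measurable borel"
  unfolding borel_prod[symmetric] by measurable

text \<open>The contaminating distribution contributes a mean loss somewhere between 0 and
  1.\<close>

lemma mean_rho_contam:
  fixes H :: "(real \<times> 'a::euclidean_space) measure"
  assumes "H \<in> contam_nbhd \<epsilon>" "0 \<le> \<epsilon>" "\<epsilon> \<le> 1"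
  shows "(1 - \<epsilon>) * mean_rho \<rho> H_o q \<le> mean_rho \<rho> H q"
    and "mean_rho \<rho> H q \<le> (1 - \<epsilon>) * mean_rho \<rho> H_o q + \<epsilon>"
proof -
  obtain \<alpha> \<theta> \<sigma> where q: "q = (\<alpha>, \<theta>, \<sigma>)" by (cases q)
  obtain Hs where H: "sets H = sets borel" "distribution Hs"
    "\<And>A. A \<in> sets borel \<Longrightarrow> emeasure H A = ennreal (1 - \<epsilon>) * emeasure H_o A + ennreal \<epsilon> * emeasure Hs A"
    using assms by (auto simp: contam_nbhd_def)
  interpret S: prob_space Hs using H by (simp add: distribution_def)
  have eq: "mean_rho \<rho> H q = (1 - \<epsilon>) * mean_rho \<rho> H_o q + \<epsilon> * mean_rho \<rho> Hs q"
    unfolding q mean_rho_def prod.case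
    by (rule integral_contam[OF H(1,2) assms(2,3) H(3) mean_rho_measurable]) auto
  have m: "(\<lambda>z. \<rho> ((fst z - \<alpha> - snd z \<bullet> \<theta>) / \<sigma>)) \<in> borel_measurable Hs"
    using H(2) mean_rho_measurable[of \<alpha> \<theta> \<sigma>] by (simp add: distribution_def cong: measurable_cong_sets)
  have "0 \<le> mean_rho \<rho> Hs q"
    unfolding q mean_rho_def by (auto intro!: integral_nonneg_AE)
  moreover have "mean_rho \<rho> Hs q \<le> (\<integral>z. 1 \<partial>Hs)"
    unfolding q mean_rho_def prod.case using m
    by (intro integral_mono S.integrable_const_bound[where B=1]) auto
  ultimately show "(1 - \<epsilon>) * mean_rho \<rho> H_o q \<le> mean_rho \<rho> H q"
    and "mean_rho \<rho> H q \<le> (1 - \<epsilon>) * mean_rho \<rho> H_o q + \<epsilon>"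
    using eq assms S.prob_space by (auto intro: mult_left_le)
qed

end

section \<open>The inequality for \<open>g\<close>\<close>

text \<open>The left side is the first diagonal Pade approximant of the logarithm. Derivatives
  compare because \<open>(2 + y)\<^sup>2\<close> is at least \<open>4 * (1 + y)\<close>.\<close>

lemma ln_one_plus_ge:
  fixes x :: real
  assumes "0 \<le> x"
  shows "2 * x / (2 + x) \<le> ln (1 + x)"
proof -
  let ?f = "\<lambda>x::real. ln (1 + x) + 4 / (2 + x)"
  have "?f 0 \<le> ?f x"
  proof (rule DERIV_nonneg_imp_nondecreasing[OF assms])
    fix y :: real assume y: "0 \<le> y" "y \<le> x"
    have "(?f has_real_derivative (1 / (1 + y) - 4 / (2 + y)\<^sup>2)) (at y)"
      using y by (auto intro!: derivative_eq_intros simp: power2_eq_square)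
    moreover have "4 / (2 + y)\<^sup>2 \<le> 4 / (4 * (1 + y))"
      using y by (intro divide_left_mono mult_pos_pos zero_less_power) (auto simp: power2_eq_square algebra_simps)
    then have "0 \<le> 1 / (1 + y) - 4 / (2 + y)\<^sup>2" by (simp flip: mult_divide_mult_cancel_left[of 4 1 "1 + y"])
    ultimately show "\<exists>z. (?f has_real_derivative z) (at y) \<and> 0 \<le> z" by blast
  qed
  moreover have "2 * x / (2 + x) = 2 - 4 / (2 + x)" using assms by (simp add: field_simps)
  ultimately show ?thesis by simp
qed

text \<open>
  With \<open>\<epsilon>\<close> replaced by its least admissible value \<open>d / (a + d)\<close>, \<open>a = 1 - b\<close>, the claim reads
  \<open>a\<^sup>2 + a d \<le> a\<^sup>2 + d\<close>.
\<close>

lemma contamination_inequality: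
  fixes b d \<epsilon> :: real
  assumes b: "0 < b" "b < 1" and "0 < d" and \<epsilon>: "0 < \<epsilon>" "\<epsilon> < 1" and d: "(1 - \<epsilon>) * d \<le> \<epsilon> * (1 - b)"
  shows "d\<^sup>2 / ((1 - b)\<^sup>2 + d) < \<epsilon> * d + b * \<epsilon>\<^sup>2 / (1 - \<epsilon>)"
proof -
  define a where "a = 1 - b"
  have a: "0 < a" "a < 1" "b = 1 - a" using b by (auto simp: a_def)
  define e where "e = d / (a + d)"
  have ad: "0 < a + d" using a \<open>0 < d\<close> by simp
  have d': "d \<le> \<epsilon> * (a + d)" using d by (simp add: a_def algebra_simps)
  have e: "0 < e" "e \<le> \<epsilon>" "e < 1"
    using a \<open>0 < d\<close> d' ad by (simp_all add: e_def pos_divide_le_eq)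
  have e1: "1 - e = a / (a + d)" using ad by (simp add: e_def diff_divide_eq_iff)
  have "d\<^sup>2 / (a\<^sup>2 + d) < d\<^sup>2 / (a * (a + d))"
  proof (rule divide_strict_left_mono)
    show "a * (a + d) < a\<^sup>2 + d" using a \<open>0 < d\<close> by (simp add: power2_eq_square distrib_left)
  qed (use a \<open>0 < d\<close> in \<open>auto intro!: mult_pos_pos add_pos_pos\<close>)
  also have "\<dots> = e * d + b * e\<^sup>2 / (1 - e)"
  proof -
    have "b * e\<^sup>2 / (1 - e) = b * d\<^sup>2 / (a * (a + d))"
      unfolding e1 using a ad by (simp add: e_def power2_eq_square)
    moreover have "e * d = a * d\<^sup>2 / (a * (a + d))"
      using a ad by (simp add: e_def power2_eq_square)
    ultimately have "e * d + b * e\<^sup>2 / (1 - e) = (a + b) * d\<^sup>2 / (a * (a + d))"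
      by (simp add: add_divide_distrib distrib_right)
    then show ?thesis by (simp add: a_def)
  qed
  also have "\<dots> \<le> \<epsilon> * d + b * \<epsilon>\<^sup>2 / (1 - \<epsilon>)"
    using e \<epsilon> b \<open>0 < d\<close> by (intro add_mono mult_mono frac_le power_mono) auto
  finally show ?thesis by (simp add: a_def)
qed

section \<open>Standing assumptions, and bounds for logarithms of scale ratios\<close>

locale cm_setting = rho_function +
  fixes b \<sigma>M :: real
  assumes A4: "cond_A4 \<rho> \<sigma>M"
    and b: "0 < b" "b < 1"
    and g_M: "g \<sigma>M < b"
    and conv: "convex_on {0<..} g"
    and phi_large: "(1 - g \<sigma>M)\<^sup>2 * (1 - b) / (2 - (b + g \<sigma>M)) \<le> phi_fun \<rho> (sigma_be \<rho> b 0)"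
begin

abbreviation "s0 \<equiv> sigma_be \<rho> b 0"
abbreviation "phi \<equiv> phi_fun \<rho>"
abbreviation "phi0 \<equiv> phi s0"

lemma sigma_M_pos: "0 < \<sigma>M"
  and phi_mono: "0 < s \<Longrightarrow> s \<le> t \<Longrightarrow> t \<le> \<sigma>M \<Longrightarrow> phi s \<le> phi t"
  using A4 by (auto simp: cond_A4_def unimodal_pos_def dest!: mono_onD[of _ _ s t])

lemma g_deriv: "0 < s \<Longrightarrow> (g has_real_derivative - phi s / s) (at s)"
proof -
  assume "0 < s"
  have "g C1_differentiable_on {0<..}" using A4 by (simp add: cond_A4_def)
  then have "g differentiable at s"
    using \<open>0 < s\<close> unfolding C1_differentiable_on_eq by simp
  then have "(g has_real_derivative deriv g s) (at s)"
    by (simp only: DERIV_deriv_iff_real_differentiable)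
  then show ?thesis using \<open>0 < s\<close> by (simp add: phi_fun_def)
qed

lemma g_cont: "continuous_on {0<..} g"
  by (auto intro!: continuous_at_imp_continuous_on DERIV_isCont[OF g_deriv])

lemma g_strict: "0 < s \<Longrightarrow> s < t \<Longrightarrow> g t < g s"
  using g_strict_antimono[OF conv sigma_M_pos] g_M b by simp

lemma g_less_iff:
  assumes "0 < s" "0 < t"
  shows "g s < g t \<longleftrightarrow> t < s"
  using g_strict[OF assms(1), of t] g_strict[OF assms(2), of s]
  by (cases s t rule: linorder_cases) auto

lemma g_le_iff:
  assumes "0 < s" "0 < t"
  shows "g s \<le> g t \<longleftrightarrow> t \<le> s"
  using g_less_iff[OF assms(2,1)] by (simp flip: not_less)

lemma g_inj: "inj_on g {0<..}"
proof (rule inj_onI)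
  fix x y assume xy: "x \<in> {0<..}" "y \<in> {0<..}" "g x = g y"
  show "x = y" using g_strict[of x y] g_strict[of y x] xy by (cases x y rule: linorder_cases) auto
qed

lemma inv_g: "0 < s \<Longrightarrow> inv_into {0<..} g (g s) = s"
  using g_inj by simp

text \<open>Since \<open>g \<sigma>M < b < 1\<close>, the value \<open>b\<close> is attained to the
  left of \<open>\<sigma>M\<close>, so the inverse in \<open>sigma_be\<close> is a genuine
  one.\<close>

lemma s0: "0 < s0" "g s0 = b" "s0 < \<sigma>M"
proof -
  obtain s where s: "0 < s" "g s = b" using g_onto[OF g_cont sigma_M_pos less_imp_le[OF g_M] b(2)] by metis
  then have "s0 = s" using inv_g[of s] by (simp add: sigma_be_def)
  with s show "0 < s0" "g s0 = b" by auto
  then show "s0 < \<sigma>M" using g_less_iff[of \<sigma>M s0] sigma_M_pos g_M by simp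
qed

text \<open>With \<open>a = 1 - b\<close> and \<open>m = 1 - g \<sigma>M\<close>, the assumed bound
  is \<open>m\<^sup>2 * a / (a + m)\<close>; as \<open>a < m\<close>, it is at least
  \<open>a\<^sup>2 / 2\<close>. The later estimates use this form.\<close>

lemma phi0_ge: "(1 - b)\<^sup>2 / 2 \<le> phi0"
proof -
  let ?a = "1 - b" and ?m = "1 - g \<sigma>M"
  have am: "0 < ?a" "?a < ?m" using b g_M by auto
  have "?a * (?a + ?m) \<le> 2 * ?m\<^sup>2"
    unfolding power2_eq_square distrib_left using am by (smt (verit) mult_mono)
  then have "?a * (?a * (?a + ?m)) \<le> ?a * (2 * ?m\<^sup>2)" using am by (intro mult_left_mono) auto
  then have "?a\<^sup>2 / 2 \<le> ?m\<^sup>2 * ?a / (?a + ?m)"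
    using am by (simp add: field_simps power2_eq_square)
  also have "\<dots> = ?m\<^sup>2 * ?a / (2 - (b + g \<sigma>M))" by (simp add: algebra_simps)
  finally show ?thesis using phi_large by linarith
qed

lemma phi0_pos: "0 < phi0"
proof -
  have "0 < (1 - b)\<^sup>2 / 2" using b by simp
  then show ?thesis using phi0_ge by linarith
qed

lemma g_above_tangent:
  assumes "0 < s" shows "b - phi0 * (s / s0 - 1) \<le> g s"
proof -
  have "- phi0 / s0 * (s - s0) \<le> g s - g s0"
    by (rule convex_on_imp_above_tangent[OF conv _ _ _ has_field_derivative_at_within[OF g_deriv[OF s0(1)]]])
       (use s0 assms in \<open>simp_all add: interior_open\<close>)
  moreover have "- phi0 / s0 * (s - s0) = - (phi0 * (s / s0 - 1))" using s0(1) by (simp add: field_simps)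
  ultimately show ?thesis using s0(2) by simp
qed

text \<open>The function \<open>phi0 * ln x + g x\<close> has derivative
  \<open>(phi0 - phi x) / x\<close>, nonnegative up to \<open>s0\<close> because \<open>phi\<close>
  increases up to \<open>\<sigma>M\<close>.\<close>

lemma ln_ratio_ge_left:
  assumes "0 < s" "s \<le> t" "t \<le> s0"
  shows "g s - g t \<le> phi0 * ln (t / s)"
proof -
  let ?f = "\<lambda>x. phi0 * ln x + g x"
  have "?f s \<le> ?f t"
  proof (rule DERIV_nonneg_imp_nondecreasing[OF assms(2)])
    fix x assume x: "s \<le> x" "x \<le> t"
    then have "0 < x" using assms by simp
    have "(?f has_real_derivative (phi0 / x + - phi x / x)) (at x)"
      using \<open>0 < x\<close> by (auto intro!: derivative_eq_intros g_deriv)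
    moreover have "phi x \<le> phi0" using phi_mono[of x s0] \<open>0 < x\<close> x assms s0 by simp
    then have "0 \<le> phi0 / x + - phi x / x" using \<open>0 < x\<close> by (simp add: divide_right_mono)
    ultimately show "\<exists>z. (?f has_real_derivative z) (at x) \<and> 0 \<le> z" by blast
  qed
  then show ?thesis using assms by (simp add: ln_div algebra_simps)
qed

text \<open>Solve the tangent inequality at \<open>s0\<close> for \<open>s / s0\<close> and take
  logarithms.\<close>

lemma ln_ratio_ge_right:
  assumes "s0 \<le> s"
  shows "ln (1 + (b - g s) / phi0) \<le> ln (s / s0)"
proof -
  have "0 \<le> (b - g s) / phi0" using phi0_pos s0 g_le_iff[of s s0] assms by simp
  moreover have "1 + (b - g s) / phi0 \<le> s / s0"
    using g_above_tangent[of s] s0 assms phi0_pos by (simp add: field_simps)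
  ultimately show ?thesis by (subst ln_le_cancel_iff) auto
qed

definition gam :: "real \<Rightarrow> real" where "gam \<epsilon> = gamma_be \<rho> b \<epsilon>"

text \<open>For \<open>\<epsilon> < 1 - b\<close> the value \<open>b / (1 - \<epsilon>)\<close> lies
  in \<open>[b, 1)\<close>, hence always in the range of \<open>g\<close>.\<close>

lemma gam:
  assumes "0 \<le> \<epsilon>" "\<epsilon> < 1 - b"
  shows "0 < gam \<epsilon>" "g (gam \<epsilon>) = b / (1 - \<epsilon>)" "gam \<epsilon> \<le> s0"
proof -
  have u: "b \<le> b / (1 - \<epsilon>)" "b / (1 - \<epsilon>) < 1" using assms b by (auto simp: field_simps)
  obtain s where s: "0 < s" "g s = b / (1 - \<epsilon>)"
    using g_onto[OF g_cont s0(1) _ u(2)] u(1) s0(2) by metis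
  then have "gam \<epsilon> = s" using inv_g[of s] by (simp add: gamma_be_def gam_def)
  with s show *: "0 < gam \<epsilon>" "g (gam \<epsilon>) = b / (1 - \<epsilon>)" by auto
  then show "gam \<epsilon> \<le> s0" using g_le_iff[of s0 "gam \<epsilon>"] s0 u by simp
qed

lemma ln_gam_ge:
  assumes "0 \<le> \<epsilon>" "\<epsilon> < 1 - b"
  shows "b * \<epsilon> / (1 - \<epsilon>) \<le> phi0 * ln (s0 / gam \<epsilon>)"
proof -
  have "b / (1 - \<epsilon>) - b \<le> phi0 * ln (s0 / gam \<epsilon>)"
    using ln_ratio_ge_left[OF gam(1,3)[OF assms]] gam(2)[OF assms] s0 by simp
  moreover have "b / (1 - \<epsilon>) - b = b * \<epsilon> / (1 - \<epsilon>)" using assms b by (simp add: field_simps)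
  ultimately show ?thesis by simp
qed

text \<open>Split the logarithm at \<open>s0\<close>. The part left of \<open>s0\<close> pays for
  \<open>b * \<epsilon> / (1 - \<epsilon>)\<close>; the part right of it yields at least
  \<open>d - d\<^sup>2 / (2 * phi0 + d)\<close>, where \<open>d = b - g s\<close>. Since
  \<open>2 * phi0\<close> is at least \<open>(1 - b)\<^sup>2\<close>,
  \<open>contamination_inequality\<close> covers what remains.\<close>

lemma ln_ratio_gam:
  assumes \<epsilon>: "0 < \<epsilon>" "\<epsilon> < 1 - b" and s: "s0 < s" "b - \<epsilon> \<le> (1 - \<epsilon>) * g s"
  shows "b - (1 - \<epsilon>) * g s < phi0 * ln (s / gam \<epsilon>)"
proof -
  define d where "d = b - g s"
  have "d > 0" using g_less_iff[of s s0] s0 s by (simp add: d_def)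
  have "\<epsilon> < 1" using \<epsilon> b by simp
  have d: "(1 - \<epsilon>) * d \<le> \<epsilon> * (1 - b)" using s by (simp add: d_def algebra_simps)
  have "b - (1 - \<epsilon>) * g s = d + \<epsilon> * (b - d)" by (simp add: d_def algebra_simps)
  also have "\<dots> = d - (\<epsilon> * d + b * \<epsilon>\<^sup>2 / (1 - \<epsilon>)) + b * \<epsilon> / (1 - \<epsilon>)"
  proof -
    have "b * \<epsilon> - b * \<epsilon>\<^sup>2 = b * \<epsilon> * (1 - \<epsilon>)" by (simp add: power2_eq_square algebra_simps)
    then have "b * \<epsilon> / (1 - \<epsilon>) - b * \<epsilon>\<^sup>2 / (1 - \<epsilon>) = b * \<epsilon>"
      using \<open>\<epsilon> < 1\<close> by (simp flip: diff_divide_distrib)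
    then show ?thesis by (simp add: algebra_simps)
  qed
  also have "\<dots> < d - d\<^sup>2 / ((1 - b)\<^sup>2 + d) + b * \<epsilon> / (1 - \<epsilon>)"
    using contamination_inequality[OF b \<open>d > 0\<close> \<epsilon>(1) \<open>\<epsilon> < 1\<close> d] by simp
  also have "\<dots> \<le> d - d\<^sup>2 / (2 * phi0 + d) + b * \<epsilon> / (1 - \<epsilon>)"
  proof -
    have "d\<^sup>2 / (2 * phi0 + d) \<le> d\<^sup>2 / ((1 - b)\<^sup>2 + d)"
      using phi0_ge phi0_pos \<open>d > 0\<close> b by (intro divide_left_mono mult_pos_pos) (auto intro!: add_pos_pos add_nonneg_pos)
    then show ?thesis by simp
  qed
  \<comment> \<open>This form is the Pade bound at \<open>d / phi0\<close>, ready for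
    \<open>ln_one_plus_ge\<close>.\<close>
  also have "d - d\<^sup>2 / (2 * phi0 + d) = phi0 * (2 * (d / phi0) / (2 + d / phi0))"
    using phi0_pos \<open>d > 0\<close> by (simp add: field_simps power2_eq_square)
  also have "\<dots> \<le> phi0 * ln (1 + d / phi0)"
    using phi0_pos \<open>d > 0\<close> by (intro mult_left_mono ln_one_plus_ge) auto
  also have "\<dots> \<le> phi0 * ln (s / s0)"
    using ln_ratio_ge_right[of s] s phi0_pos by (intro mult_left_mono) (auto simp: d_def)
  also have "b * \<epsilon> / (1 - \<epsilon>) \<le> phi0 * ln (s0 / gam \<epsilon>)"
    using ln_gam_ge \<epsilon> by simp
  finally have "b - (1 - \<epsilon>) * g s < phi0 * ln (s / s0) + phi0 * ln (s0 / gam \<epsilon>)" by simp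
  also have "\<dots> = phi0 * ln (s / gam \<epsilon>)"
    using s s0 gam(1)[of \<epsilon>] \<epsilon> by (simp add: ln_div algebra_simps)
  finally show ?thesis .
qed

lemma sigma_eps_gt:
  assumes "0 < \<epsilon>" "\<epsilon> < 1" "0 < s" "g s = (b - \<epsilon>) / (1 - \<epsilon>)"
  shows "s0 < s"
proof -
  have "\<epsilon> * b < \<epsilon>" using assms b by simp
  then have "(b - \<epsilon>) / (1 - \<epsilon>) < b" using assms by (simp add: field_simps)
  then show ?thesis using g_less_iff[of s s0] s0 assms by simp
qed

text \<open>At this scale the left side of \<open>ln_ratio_gam\<close> equals \<epsilon>; dividing
  by it says that \<open>c_fun\<close> exceeds \<open>1 / phi0\<close>.\<close>

lemma c_fun_gt:
  assumes \<epsilon>: "0 < \<epsilon>" "\<epsilon> < 1 - b" and s: "0 < s" "g s = (b - \<epsilon>) / (1 - \<epsilon>)"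
  shows "\<epsilon> < phi0 * ln (s / gam \<epsilon>)"
proof -
  have "\<epsilon> < 1" using \<epsilon> b by simp
  then have "(1 - \<epsilon>) * g s = b - \<epsilon>" using s by simp
  then show ?thesis using ln_ratio_gam[OF \<epsilon> sigma_eps_gt[OF \<epsilon>(1) \<open>\<epsilon> < 1\<close> s]] by simp
qed

section \<open>The end points \<open>c_o\<close> and \<open>c_1\<close> of the range of tuning
  constants\<close>

lemma c_o_eq: "c_o \<rho> b = 1 / phi0"
proof -
  define R where "R = {\<epsilon>. 0 < \<epsilon> \<and> \<epsilon> < min b (1 - b) \<and>
     (b - \<epsilon>) / (1 - \<epsilon>) \<in> g ` {0<..} \<and> b / (1 - \<epsilon>) \<in> g ` {0<..}}"
  define c where "c = c_fun \<rho> b"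
  have lower: "1 / phi0 \<le> c \<epsilon>" if "\<epsilon> \<in> R" for \<epsilon>
  proof -
    obtain s where s: "0 < s" "g s = (b - \<epsilon>) / (1 - \<epsilon>)" using \<open>\<epsilon> \<in> R\<close> by (auto simp: R_def)
    have \<epsilon>: "0 < \<epsilon>" "\<epsilon> < 1 - b" using \<open>\<epsilon> \<in> R\<close> by (auto simp: R_def)
    have "sigma_be \<rho> b \<epsilon> = s" using inv_g[OF s(1)] s(2) by (simp add: sigma_be_def)
    then have "c \<epsilon> = ln (s / gam \<epsilon>) / \<epsilon>" by (simp add: c_def c_fun_def gam_def)
    then show ?thesis
      using c_fun_gt[OF \<epsilon> s] phi0_pos \<epsilon>(1) by (simp add: pos_divide_le_eq pos_le_divide_eq mult.commute)
  qed
  \<comment> \<open>The lower bound is sharp as \<epsilon> tends to 0: \<open>c_fun\<close> is the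
    difference quotient at 0 of \<open>?D\<close>. The derivative of \<open>G\<close> at
    \<open>b\<close> is \<open>- 1 / phi0\<close>, and the two inner arguments have derivatives
    \<open>b - 1\<close> and \<open>b\<close>, so the limit is \<open>1 / phi0\<close>.\<close>
  define G where "G u = ln (inv_into {0<..} g u)" for u
  have "((inv_into {0<..} g) has_real_derivative inverse (- phi0 / s0)) (at (g s0))"
    using s0 phi0_pos g_cont by (intro has_field_derivative_inverse_strong[OF g_deriv, of s0 "{0<..}"]) (auto simp: inv_g)
  then have "(G has_real_derivative (1 / s0 * inverse (- phi0 / s0))) (at (g s0))"
    unfolding G_def using s0 inv_g[of s0]
    by (auto intro!: derivative_eq_intros)
  then have dG: "(G has_real_derivative (- 1 / phi0)) (at b)" using s0 by (simp add: field_simps)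
  let ?D = "\<lambda>e. G ((b - e) / (1 - e)) - G (b / (1 - e))"
  have d1: "((\<lambda>e. (b - e) / (1 - e)) has_real_derivative (b - 1)) (at 0)"
    by (auto intro!: derivative_eq_intros)
  have d2: "((\<lambda>e. b / (1 - e)) has_real_derivative b) (at 0)"
    by (auto intro!: derivative_eq_intros)
  have "(?D has_real_derivative ((- 1 / phi0) * (b - 1) - (- 1 / phi0) * b)) (at 0)"
    by (intro DERIV_diff DERIV_chain2[OF _ d1] DERIV_chain2[OF _ d2]) (use dG in simp_all)
  moreover have "(- 1 / phi0) * (b - 1) - (- 1 / phi0) * b = 1 / phi0"
    by (simp add: diff_divide_distrib)
  ultimately have "(?D has_real_derivative (1 / phi0)) (at 0)"
    by simp
  then have "((\<lambda>e. ?D e / e) \<longlongrightarrow> 1 / phi0) (at 0)"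
    by (simp add: DERIV_def)
  then have lim: "((\<lambda>e. ?D e / e) \<longlongrightarrow> 1 / phi0) (at_right 0)"
    by (rule filterlim_mono) (auto intro: at_le)
  \<comment> \<open>Both range conditions hold near 0: the first value stays above
    \<open>g \<sigma>M\<close>, and \<open>gam\<close> realizes the second.\<close>
  have inR: "\<forall>\<^sub>F e in at_right 0. e \<in> R \<and> ?D e / e = c e"
  proof -
    have "((\<lambda>e. (b - e) / (1 - e)) \<longlongrightarrow> (b - 0) / (1 - 0)) (at_right 0)"
      by (intro tendsto_intros) auto
    then have "\<forall>\<^sub>F e in at_right 0. g \<sigma>M < (b - e) / (1 - e)"
      using order_tendstoD(1) g_M by fastforce
    moreover have "\<forall>\<^sub>F e in at_right 0. e \<in> {0<..<min b (1 - b)}"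
      using b by (intro eventually_at_right_real) auto
    ultimately show ?thesis
    proof eventually_elim
      fix e assume e: "g \<sigma>M < (b - e) / (1 - e)" "e \<in> {0<..<min b (1 - b)}"
      have "(b - e) / (1 - e) < 1" using e b by simp
      then obtain s where s: "0 < s" "g s = (b - e) / (1 - e)"
        using g_onto[OF g_cont sigma_M_pos] e(1) less_imp_le by metis
      have gm: "0 < gam e" "g (gam e) = b / (1 - e)" using gam[of e] e by auto
      have "(b - e) / (1 - e) \<in> g ` {0<..}" using s by (intro image_eqI[of _ _ s]) simp_all
      moreover have "b / (1 - e) \<in> g ` {0<..}" using gm by (intro image_eqI[of _ _ "gam e"]) simp_all
      ultimately have "e \<in> R" using e unfolding R_def by simp
      moreover have "?D e = ln (s / gam e)"
        unfolding G_def s(2)[symmetric] gm(2)[symmetric] inv_g[OF s(1)] inv_g[OF gm(1)]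
        using s(1) gm(1) by (simp add: ln_div)
      moreover have "c e = ln (s / gam e) / e"
        using inv_g[OF s(1)] unfolding s(2) by (simp add: c_def c_fun_def gam_def sigma_be_def)
      ultimately show "e \<in> R \<and> ?D e / e = c e" by simp
    qed
  qed
  have "R \<noteq> {}" using eventually_happens[OF inR] by auto
  have "Inf (c ` R) = 1 / phi0"
  proof (rule antisym)
    show "1 / phi0 \<le> Inf (c ` R)" using \<open>R \<noteq> {}\<close> lower by (intro cINF_greatest)
    show "Inf (c ` R) \<le> 1 / phi0"
    proof (rule tendsto_lowerbound[OF lim])
      show "\<forall>\<^sub>F e in at_right 0. Inf (c ` R) \<le> ?D e / e"
        using inR
      proof eventually_elim
        fix e assume e: "e \<in> R \<and> ?D e / e = c e"
        then show "Inf (c ` R) \<le> ?D e / e"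
          using lower by (auto intro!: cINF_lower bdd_belowI2)
      qed
    qed simp
  qed
  then show ?thesis unfolding c_o_def R_def c_def .
qed

text \<open>Otherwise \<open>phi0 * ln x + g x\<close> would be no larger at \<open>s0\<close> than
  at \<open>\<sigma>M\<close>. It is nonincreasing between them, where \<open>phi\<close> is at
  least \<open>phi0\<close>, so it would be constant there and \<open>g\<close> logarithmic,
  contrary to \<open>gaussian_scale_not_log\<close>.\<close>

lemma c_1_less: "c_1 \<rho> b \<sigma>M < 1 / phi0"
proof (rule ccontr)
  assume "\<not> ?thesis"
  then have ge: "b - g \<sigma>M \<le> phi0 * ln (\<sigma>M / s0)"
    using phi0_pos g_M by (simp add: c_1_def field_simps)
  let ?f = "\<lambda>x. phi0 * ln x + g x"
  have f_anti: "?f t \<le> ?f s" if "s0 \<le> s" "s \<le> t" "t \<le> \<sigma>M" for s t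
  proof (rule DERIV_nonpos_imp_nonincreasing[OF that(2)])
    fix x assume x: "s \<le> x" "x \<le> t"
    then have "0 < x" using s0 that by simp
    have "(?f has_real_derivative (phi0 / x + - phi x / x)) (at x)"
      using \<open>0 < x\<close> by (auto intro!: derivative_eq_intros g_deriv)
    moreover have "phi0 \<le> phi x" using phi_mono[of s0 x] x that s0 by simp
    then have "phi0 / x + - phi x / x \<le> 0" using \<open>0 < x\<close> by (simp add: divide_right_mono)
    ultimately show "\<exists>z. (?f has_real_derivative z) (at x) \<and> z \<le> 0" by blast
  qed
  have "?f s0 \<le> ?f \<sigma>M" using ge s0 sigma_M_pos by (simp add: ln_div algebra_simps)
  then have "g s = (phi0 * ln s0 + b) - phi0 * ln s" if "s0 < s" "s < \<sigma>M" for s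
    using f_anti[of s0 s] f_anti[of s \<sigma>M] that s0 by simp
  then show False
    using gaussian_scale_not_log[OF rho_measurable, of 1 s0 \<sigma>M phi0 "phi0 * ln s0 + b"] s0 phi0_pos
    by (simp add: g_fun_def)
qed

end

section \<open>Maximum bias\<close>

lemma solution_imp_minimizing_limit:
  assumes "solution F P q" and pos: "\<And>q. P q \<Longrightarrow> 0 < snd (snd q)"
  shows "minimizing_limit F P q"
proof (cases "\<exists>q'. is_arg_min F P q'")
  case True
  then have q: "P q" "\<And>q'. P q' \<Longrightarrow> F q \<le> F q'"
    using assms(1) by (auto simp: solution_def is_arg_min_def not_less)
  have "F q < F q' + e" if "P q'" "0 < e" for q' and e :: real
    using q(2)[OF that(1)] that(2) by linarith
  then have "\<forall>q'. P q' \<longrightarrow> (\<forall>e>0. \<forall>\<^sub>F n in sequentially. F q < F q' + e)" by simp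
  \<comment> \<open>A minimizer is the limit of the constant sequence, so later arguments treat both
    cases of \<open>solution\<close> at once.\<close>
  then show ?thesis
    unfolding minimizing_limit_def using pos[OF q(1)] q(1)
    by (intro conjI exI[of _ "\<lambda>_. q"]) auto
qed (use assms in \<open>auto simp: solution_def\<close>)

text \<open>In the definition the index may depend on the competitor \<open>q'\<close>. Comparing
  with one competitor close to the infimum, which is finite by the lower bound, makes it
  uniform.\<close>

lemma minimizing_limit_near_minimal:
  assumes "minimizing_limit F P q" and bdd: "\<And>q. P q \<Longrightarrow> m \<le> F q"
  obtains X where "X \<longlonglongrightarrow> q" "\<And>n. P (X n)"
    "\<And>d. 0 < d \<Longrightarrow> \<forall>\<^sub>F n in sequentially. \<forall>q'. P q' \<longrightarrow> F (X n) < F q' + d"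
proof -
  obtain X where X: "\<And>n. P (X n)" "X \<longlonglongrightarrow> q"
    "\<And>q' e. P q' \<Longrightarrow> 0 < e \<Longrightarrow> \<forall>\<^sub>F n in sequentially. F (X n) < F q' + e"
    using assms(1) unfolding minimizing_limit_def by blast
  have below: "bdd_below (F ` Collect P)" using bdd by (auto intro!: bdd_belowI2)
  have ne: "F ` Collect P \<noteq> {}" using X(1) by blast
  have "\<forall>\<^sub>F n in sequentially. \<forall>q'. P q' \<longrightarrow> F (X n) < F q' + d" if "0 < d" for d
  proof -
    have "Inf (F ` Collect P) < Inf (F ` Collect P) + d / 2" using that by simp
    then obtain q'' where q'': "P q''" "F q'' < Inf (F ` Collect P) + d / 2"
      using cInf_lessD[OF ne] by blast
    have "\<forall>\<^sub>F n in sequentially. F (X n) < F q'' + d / 2" using X(3)[OF q''(1)] that by simp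
    then show ?thesis
    proof eventually_elim
      fix n assume n: "F (X n) < F q'' + d / 2"
      show "\<forall>q'. P q' \<longrightarrow> F (X n) < F q' + d"
      proof (intro allI impI)
        fix q' assume "P q'"
        then have "Inf (F ` Collect P) \<le> F q'" using below by (intro cInf_lower) auto
        then show "F (X n) < F q' + d" using n q''(2) by linarith
      qed
    qed
  qed
  with X show ?thesis using that by blast
qed

text \<open>No continuity of \<open>F\<close> is assumed, so compactness alone does not give a
  minimizer. If there is none, a subsequence of a minimizing sequence converges in \<open>K\<close>,
  where scales are positive, and its limit is a solution.\<close>

lemma ex_solution:
  fixes F :: "real \<times> 'a::euclidean_space \<times> real \<Rightarrow> real"
  assumes "P q0" and bdd: "\<And>q. P q \<Longrightarrow> m \<le> F q"
    and compact: "compact K" "\<And>q. P q \<Longrightarrow> F q < F q0 + 1 \<Longrightarrow> q \<in> K" "\<And>q. q \<in> K \<Longrightarrow> 0 < snd (snd q)"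
  shows "\<exists>q. solution F P q"
proof (cases "\<exists>q'. is_arg_min F P q'")
  case True
  then show ?thesis by (auto simp: solution_def)
next
  case False
  define I where "I = Inf (F ` Collect P)"
  have ne: "F ` Collect P \<noteq> {}" using assms(1) by blast
  have below: "bdd_below (F ` Collect P)" using bdd by (auto intro!: bdd_belowI2)
  have I_le: "I \<le> F q" if "P q" for q unfolding I_def using below that by (intro cInf_lower) auto
  have "\<exists>q. P q \<and> F q < I + 1 / real (Suc n)" for n
  proof -
    have "Inf (F ` Collect P) < I + 1 / real (Suc n)" by (simp add: I_def)
    then show ?thesis using cInf_lessD[OF ne] by blast
  qed
  then obtain X where X: "\<And>n. P (X n)" "\<And>n. F (X n) < I + 1 / real (Suc n)" by metis
  have "X n \<in> K" for n
  proof (rule compact(2)[OF X(1)])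
    have "1 / real (Suc n) \<le> 1" by simp
    then show "F (X n) < F q0 + 1" using X(2)[of n] I_le[OF assms(1)] by linarith
  qed
  then obtain l r where l: "l \<in> K" "strict_mono (r :: nat \<Rightarrow> nat)" "(X \<circ> r) \<longlonglongrightarrow> l"
    using compact(1) unfolding compact_def by metis
  have "minimizing_limit F P l"
    unfolding minimizing_limit_def
  proof (intro conjI exI[of _ "X \<circ> r"] allI impI)
    show "0 < snd (snd l)" using compact(3) l by blast
    show "(X \<circ> r) \<longlonglongrightarrow> l" by fact
    fix q' :: "real \<times> 'a \<times> real" and e :: real assume "P q'" "0 < e"
    have "\<forall>\<^sub>F n in sequentially. 1 / real (Suc n) < e"
      using order_tendstoD(2)[OF LIMSEQ_inverse_real_of_nat \<open>0 < e\<close>] by (simp add: divide_inverse)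
    then show "\<forall>\<^sub>F n in sequentially. F ((X \<circ> r) n) < F q' + e"
    proof eventually_elim
      fix n assume n: "1 / real (Suc n) < e"
      have "1 / real (Suc (r n)) \<le> 1 / real (Suc n)"
        using seq_suble[OF l(2), of n] by (intro divide_left_mono) auto
      then show "F ((X \<circ> r) n) < F q' + e"
        using X(2)[of "r n"] I_le[OF \<open>P q'\<close>] n by simp
    qed
  qed (use X in auto)
  then show ?thesis unfolding solution_def if_not_P[OF False] by blast
qed

lemma one_le_sqrt_one_plus: "1 \<le> sqrt (1 + (norm x)\<^sup>2)"
  by simp

lemma sqrt_one_plus_pos: "0 < sqrt (1 + (norm x)\<^sup>2)"
  using one_le_sqrt_one_plus[of x] by linarith

section \<open>Feasible parameters, and lower bounds for the maximum bias of the S-estimate\<close>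

context cm_setting
begin

lemma feasible_scale_pos: "feasible \<rho> b H q \<Longrightarrow> 0 < snd (snd q)"
  by (auto simp: feasible_def)

text \<open>The uncontaminated part alone must satisfy the constraint, and dropping the intercept
  only lowers its mean loss; so \<open>g\<close> at the standardized scale is at most
  \<open>g (gam \<epsilon>)\<close>.\<close>

lemma feasible_bounds:
  fixes H :: "(real \<times> 'a::euclidean_space) measure"
  assumes \<epsilon>: "0 < \<epsilon>" "\<epsilon> < 1 - b" and H: "H \<in> contam_nbhd \<epsilon>" and q: "feasible \<rho> b H (\<alpha>, \<theta>, \<sigma>)"
  shows "mean_rho \<rho> H_o (\<alpha>, \<theta>, \<sigma>) \<le> b / (1 - \<epsilon>)"
    and "gam \<epsilon> \<le> \<sigma> / sqrt (1 + (norm \<theta>)\<^sup>2)"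
    and "gam \<epsilon> \<le> \<sigma>"
proof -
  have \<epsilon>1: "\<epsilon> < 1" using \<epsilon> b by simp
  have \<sigma>: "0 < \<sigma>" "mean_rho \<rho> H (\<alpha>, \<theta>, \<sigma>) \<le> b" using q by (auto simp: feasible_def)
  have "(1 - \<epsilon>) * mean_rho \<rho> H_o (\<alpha>, \<theta>, \<sigma>) \<le> b"
    using mean_rho_contam(1)[OF H] \<epsilon>(1) \<epsilon>1 \<sigma>(2) by (meson less_imp_le order_trans)
  then show m: "mean_rho \<rho> H_o (\<alpha>, \<theta>, \<sigma>) \<le> b / (1 - \<epsilon>)"
    using \<epsilon>1 by (simp add: pos_le_divide_eq mult.commute)
  let ?s = "\<sigma> / sqrt (1 + (norm \<theta>)\<^sup>2)"
  have s: "0 < ?s" by (rule divide_pos_pos[OF \<sigma>(1) sqrt_one_plus_pos])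
  have "g ?s \<le> g (gam \<epsilon>)"
    using mean_rho_H_o_ge[OF \<sigma>(1), of \<theta> \<alpha>] m gam(2)[of \<epsilon>] \<epsilon> by simp
  then show l: "gam \<epsilon> \<le> ?s" using g_le_iff[OF s] gam(1)[of \<epsilon>] \<epsilon> by simp
  have "?s \<le> \<sigma> / 1" using one_le_sqrt_one_plus[of \<theta>] sqrt_one_plus_pos[of \<theta>] \<sigma>(1)
    by (intro divide_left_mono) auto
  then show "gam \<epsilon> \<le> \<sigma>" using l by simp
qed

text \<open>
  The contaminating point mass sits at \<open>x = n e\<close> on the regression line with slope \<open>\<tau> e\<close>. If a
  solution treated it as an outlier, its scale would exceed that of the fit through the
  point; as \<open>n\<close> grows, a bounded residual forces the slope along \<open>e\<close> towards \<open>\<tau>\<close>.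
\<close>

lemma max_bias_S_ge:
  fixes T :: "(real \<times> 'a::euclidean_space) measure \<Rightarrow> 'a option"
  assumes T: "S_slope \<rho> b T" and \<epsilon>: "0 < \<epsilon>" "\<epsilon> < 1 - b" and "0 \<le> \<tau>"
    and \<tau>: "b < (1 - \<epsilon>) * g (sqrt (1 + \<tau>\<^sup>2) * gam \<epsilon>) + \<epsilon>"
  shows "ereal \<tau> \<le> max_bias T \<epsilon>"
proof -
  have \<epsilon>1: "\<epsilon> < 1" using \<epsilon> b by simp
  have gm: "0 < gam \<epsilon>" "g (gam \<epsilon>) = b / (1 - \<epsilon>)" using gam[of \<epsilon>] \<epsilon> by auto
  define \<sigma>1 where "\<sigma>1 = sqrt (1 + \<tau>\<^sup>2) * gam \<epsilon>"
  have sq: "0 < sqrt (1 + \<tau>\<^sup>2)" by (simp add: add_pos_nonneg)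
  then have "0 < \<sigma>1" using gm(1) unfolding \<sigma>1_def by (rule mult_pos_pos)
  \<comment> \<open>Near-minimizers may slightly exceed the scale \<open>\<sigma>1\<close> of the
    comparison fit; continuity of \<open>g\<close> preserves the assumed strict inequality at some
    larger \<open>S\<close>.\<close>
  obtain S where S: "\<sigma>1 < S" "b < (1 - \<epsilon>) * g S + \<epsilon>"
  proof -
    have "((\<lambda>s. (1 - \<epsilon>) * g s + \<epsilon>) \<longlongrightarrow> (1 - \<epsilon>) * g \<sigma>1 + \<epsilon>) (at_right \<sigma>1)"
      using DERIV_isCont[OF g_deriv[OF \<open>0 < \<sigma>1\<close>]]
      by (intro tendsto_intros) (auto simp: isCont_def intro: filterlim_mono at_le)
    then have "\<forall>\<^sub>F s in at_right \<sigma>1. b < (1 - \<epsilon>) * g s + \<epsilon>"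
      using order_tendstoD(1) \<tau> unfolding \<sigma>1_def by blast
    moreover have "\<forall>\<^sub>F s in at_right \<sigma>1. \<sigma>1 < s" by (simp add: eventually_at_filter)
    ultimately have "\<forall>\<^sub>F s in at_right \<sigma>1. b < (1 - \<epsilon>) * g s + \<epsilon> \<and> \<sigma>1 < s" by (rule eventually_conj)
    then show ?thesis using that by (auto dest!: eventually_happens)
  qed
  have "0 < S" using S \<open>0 < \<sigma>1\<close> by simp
  \<comment> \<open>\<open>K\<close> is chosen so that, at scales up to \<open>S\<close>, a
    standardized residual of size \<open>K\<close> or more at the point mass violates the
    constraint.\<close>
  have "(b - (1 - \<epsilon>) * g S) / \<epsilon> < 1" using S(2) \<epsilon> by (simp add: pos_divide_less_eq)
  then obtain K where K: "K > 0" "(b - (1 - \<epsilon>) * g S) / \<epsilon> < \<rho> K" using rho_near_1 by blast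
  have K': "b < (1 - \<epsilon>) * g S + \<epsilon> * \<rho> K" using K(2) \<epsilon> by (simp add: pos_divide_less_eq algebra_simps)
  have "b / (1 - \<epsilon>) < 1" using \<epsilon> \<epsilon>1 by (simp add: pos_divide_less_eq)
  then obtain A where A: "\<And>\<alpha> (\<theta> :: 'a) \<sigma>. 0 < \<sigma> \<Longrightarrow> \<sigma> \<le> S \<Longrightarrow>
    gam \<epsilon> \<le> \<sigma> / sqrt (1 + (norm \<theta>)\<^sup>2) \<Longrightarrow> mean_rho \<rho> H_o (\<alpha>, \<theta>, \<sigma>) \<le> b / (1 - \<epsilon>) \<Longrightarrow> \<bar>\<alpha>\<bar> \<le> A"
    using intercept_bounded[OF _ gm(1) \<open>0 < S\<close>] by metis
  \<comment> \<open>Bounds intercept plus raw residual independently of the position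
    \<open>n\<close> of the point mass; the slope error is then at most
    \<open>C / n\<close>.\<close>
  define C where "C = A + K * S"
  obtain e :: 'a where e: "e \<in> Basis" using nonempty_Basis by blast
  then have [simp]: "norm e = 1" by simp
  have step: "ereal (\<tau> - C / real (Suc k)) \<le> max_bias T \<epsilon>" for k
  proof -
    define n where "n = real (Suc k)"
    have "n > 0" by (simp add: n_def)
    obtain H where H: "H \<in> contam_nbhd \<epsilon>"
      "\<And>f :: real \<times> 'a \<Rightarrow> real. f \<in> borel_measurable borel \<Longrightarrow> (\<And>x. 0 \<le> f x) \<Longrightarrow> (\<And>x. f x \<le> 1) \<Longrightarrow>
         (\<integral>x. f x \<partial>H) = (1 - \<epsilon>) * (\<integral>x. f x \<partial>H_o) + \<epsilon> * f (n * \<tau>, n *\<^sub>R e)"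
      using contam_point_mass[of \<epsilon> "(n * \<tau>, n *\<^sub>R e)"] \<epsilon> \<epsilon>1 by (metis less_imp_le)
    have mean: "mean_rho \<rho> H (\<alpha>, \<theta>, \<sigma>) = (1 - \<epsilon>) * mean_rho \<rho> H_o (\<alpha>, \<theta>, \<sigma>) +
        \<epsilon> * \<rho> ((n * (\<tau> - e \<bullet> \<theta>) - \<alpha>) / \<sigma>)" for \<alpha> \<theta> \<sigma>
    proof -
      let ?z = "(n * \<tau>, n *\<^sub>R e)"
      have eq: "fst ?z - \<alpha> - snd ?z \<bullet> \<theta> = n * (\<tau> - e \<bullet> \<theta>) - \<alpha>" by (simp add: algebra_simps)
      have "mean_rho \<rho> H (\<alpha>, \<theta>, \<sigma>) = (1 - \<epsilon>) * mean_rho \<rho> H_o (\<alpha>, \<theta>, \<sigma>) +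
          \<epsilon> * \<rho> ((fst ?z - \<alpha> - snd ?z \<bullet> \<theta>) / \<sigma>)"
        unfolding mean_rho_def prod.case by (rule H(2)[OF mean_rho_measurable]) simp_all
      then show ?thesis unfolding eq .
    qed
    \<comment> \<open>This fit passes through the point mass, so contamination costs nothing, and
      its standardized scale \<open>gam \<epsilon>\<close> exhausts the budget
      \<open>b\<close>.\<close>
    have q1: "feasible \<rho> b H (0, \<tau> *\<^sub>R e, \<sigma>1)"
    proof -
      have "e \<bullet> e = 1" using e by simp
      moreover have "mean_rho \<rho> H_o (0, \<tau> *\<^sub>R e, \<sigma>1) = b / (1 - \<epsilon>)"
        unfolding mean_rho_H_o_0 using sq gm by (simp add: \<sigma>1_def)
      ultimately show ?thesis using \<open>0 < \<sigma>1\<close> \<epsilon>1 by (simp add: feasible_def mean)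
    qed
    have close: "n * \<bar>\<tau> - e \<bullet> \<theta>\<bar> \<le> C" if q: "feasible \<rho> b H (\<alpha>, \<theta>, \<sigma>)" and "\<sigma> \<le> S" for \<alpha> \<theta> \<sigma>
    proof -
      have \<sigma>: "0 < \<sigma>" "mean_rho \<rho> H (\<alpha>, \<theta>, \<sigma>) \<le> b" using q by (auto simp: feasible_def)
      note fb = feasible_bounds[OF \<epsilon> H(1) q]
      have "\<bar>\<alpha>\<bar> \<le> A" by (rule A[OF \<sigma>(1) \<open>\<sigma> \<le> S\<close> fb(2,1)])
      let ?s = "\<sigma> / sqrt (1 + (norm \<theta>)\<^sup>2)" and ?r = "n * (\<tau> - e \<bullet> \<theta>) - \<alpha>"
      have "0 < ?s" using fb(2) gm(1) by linarith
      have "?s \<le> \<sigma> / 1" using one_le_sqrt_one_plus[of \<theta>] sqrt_one_plus_pos[of \<theta>] \<sigma>(1)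
    by (intro divide_left_mono) auto
      then have "g S \<le> g ?s" using \<open>\<sigma> \<le> S\<close> by (intro g_antimono \<open>0 < ?s\<close>) simp
      then have "g S \<le> mean_rho \<rho> H_o (\<alpha>, \<theta>, \<sigma>)" using mean_rho_H_o_ge[OF \<sigma>(1), of \<theta> \<alpha>] by simp
      then have "(1 - \<epsilon>) * g S \<le> (1 - \<epsilon>) * mean_rho \<rho> H_o (\<alpha>, \<theta>, \<sigma>)" using \<epsilon>1 by (intro mult_left_mono) auto
      then have "\<epsilon> * \<rho> (?r / \<sigma>) < \<epsilon> * \<rho> K" using \<sigma>(2) K' unfolding mean by linarith
      then have "\<rho> (?r / \<sigma>) < \<rho> K" using \<epsilon> by simp
      then have "\<not> \<bar>K\<bar> \<le> \<bar>?r / \<sigma>\<bar>" using rho_mono by (metis not_less)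
      then have "\<bar>?r\<bar> / \<sigma> < K" using K \<sigma>(1) by (simp add: abs_divide)
      then have "\<bar>?r\<bar> < K * \<sigma>" using \<sigma>(1) by (simp add: pos_divide_less_eq)
      also have "\<dots> \<le> K * S" using K \<open>\<sigma> \<le> S\<close> by (intro mult_left_mono) auto
      finally have "\<bar>n * (\<tau> - e \<bullet> \<theta>)\<bar> \<le> C" using \<open>\<bar>\<alpha>\<bar> \<le> A\<close> unfolding C_def by linarith
      then show ?thesis using \<open>n > 0\<close> by (simp add: abs_mult)
    qed
    have "ereal (\<tau> - C / n) \<le> bias T H"
    proof (cases "T H")
      case None
      then show ?thesis by (simp add: bias_def)
    next
      case (Some \<theta>)
      have "distribution H" using distribution_contam[OF H(1)] \<epsilon> \<epsilon>1 by simp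
      then obtain \<alpha> \<sigma> where sol: "solution S_objective (feasible \<rho> b H) (\<alpha>, \<theta>, \<sigma>)"
        using T Some unfolding S_slope_def selects_slopes_def by fastforce
      have "minimizing_limit S_objective (feasible \<rho> b H) (\<alpha>, \<theta>, \<sigma>)"
        by (rule solution_imp_minimizing_limit[OF sol feasible_scale_pos])
      then obtain X where X: "\<And>n. feasible \<rho> b H (X n)" "X \<longlonglongrightarrow> (\<alpha>, \<theta>, \<sigma>)"
        and min: "\<And>q' e. feasible \<rho> b H q' \<Longrightarrow> 0 < e \<Longrightarrow>
          \<forall>\<^sub>F n in sequentially. S_objective (X n) < S_objective q' + e"
        unfolding minimizing_limit_def by blast
      have "\<forall>\<^sub>F n in sequentially. S_objective (X n) < S_objective (0, \<tau> *\<^sub>R e, \<sigma>1) + (S - \<sigma>1)"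
        using min[OF q1] S(1) by simp
      then have ev: "\<forall>\<^sub>F i in sequentially. n * \<bar>\<tau> - e \<bullet> fst (snd (X i))\<bar> \<le> C"
      proof eventually_elim
        fix i assume i: "S_objective (X i) < S_objective (0, \<tau> *\<^sub>R e, \<sigma>1) + (S - \<sigma>1)"
        obtain \<alpha>' \<theta>' \<sigma>' where Xi: "X i = (\<alpha>', \<theta>', \<sigma>')" by (cases "X i")
        show "n * \<bar>\<tau> - e \<bullet> fst (snd (X i))\<bar> \<le> C"
          using close[of \<alpha>' \<theta>' \<sigma>'] X(1)[of i] i by (simp add: Xi S_objective_def)
      qed
      have "(\<lambda>i. n * \<bar>\<tau> - e \<bullet> fst (snd (X i))\<bar>) \<longlonglongrightarrow> n * \<bar>\<tau> - e \<bullet> fst (snd (\<alpha>, \<theta>, \<sigma>))\<bar>"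
        by (intro tendsto_intros X(2))
      then have "n * \<bar>\<tau> - e \<bullet> \<theta>\<bar> \<le> C" using tendsto_upperbound[OF _ ev] by simp
      then have "\<bar>\<tau> - e \<bullet> \<theta>\<bar> \<le> C / n" using \<open>n > 0\<close> by (simp add: pos_le_divide_eq mult.commute)
      moreover have "e \<bullet> \<theta> \<le> norm \<theta>" using norm_cauchy_schwarz[of e \<theta>] by simp
      ultimately have "\<tau> - C / n \<le> norm \<theta>" by linarith
      then show ?thesis by (simp add: bias_def Some)
    qed
    also have "\<dots> \<le> max_bias T \<epsilon>" unfolding max_bias_def using H(1) by (rule SUP_upper)
    finally show ?thesis by (simp add: n_def)
  qed
  have "(\<lambda>k. \<tau> - C * inverse (real (Suc k))) \<longlonglongrightarrow> \<tau> - C * 0"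
    by (intro tendsto_intros LIMSEQ_inverse_real_of_nat)
  then have "(\<lambda>k. ereal (\<tau> - C / real (Suc k))) \<longlonglongrightarrow> ereal \<tau>"
    by (simp add: divide_inverse)
  then show ?thesis by (rule tendsto_upperbound) (use step in auto)
qed

text \<open>Every positive \<tau> below the bound satisfies
  \<open>sqrt (1 + \<tau>\<^sup>2) * gam \<epsilon> < s\<close>; strict monotonicity of
  \<open>g\<close> then gives the hypothesis of \<open>max_bias_S_ge\<close>, and \<tau> may
  approach the bound.\<close>

lemma max_bias_S_lower_bound:
  fixes T :: "(real \<times> 'a::euclidean_space) measure \<Rightarrow> 'a option"
  assumes T: "S_slope \<rho> b T" and \<epsilon>: "0 < \<epsilon>" "\<epsilon> < 1 - b" and s: "0 < s" "g s = (b - \<epsilon>) / (1 - \<epsilon>)"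
  shows "ereal (sqrt ((s / gam \<epsilon>)\<^sup>2 - 1)) \<le> max_bias T \<epsilon>"
proof -
  have \<epsilon>1: "\<epsilon> < 1" using \<epsilon> b by simp
  have gm: "0 < gam \<epsilon>" "gam \<epsilon> \<le> s0" using gam[of \<epsilon>] \<epsilon> by auto
  have "gam \<epsilon> < s" using sigma_eps_gt[OF \<epsilon>(1) \<epsilon>1 s] gm by simp
  then have "1 < s / gam \<epsilon>" using gm by simp
  then have "0 < (s / gam \<epsilon>)\<^sup>2 - 1" by (simp add: one_less_power)
  then have "0 < ereal (sqrt ((s / gam \<epsilon>)\<^sup>2 - 1))" by simp
  then show ?thesis
  proof (rule dense_le_bounded)
    fix w assume w: "0 < w" "w < ereal (sqrt ((s / gam \<epsilon>)\<^sup>2 - 1))"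
    then obtain \<tau> where \<tau>: "w = ereal \<tau>" by (cases w) auto
    have "0 < \<tau>" "\<tau> < sqrt ((s / gam \<epsilon>)\<^sup>2 - 1)" using w \<tau> by auto
    then have "\<tau>\<^sup>2 < (s / gam \<epsilon>)\<^sup>2 - 1"
      using real_less_rsqrt power_strict_mono[of \<tau> _ 2] \<open>0 < (s / gam \<epsilon>)\<^sup>2 - 1\<close>
      by (metis less_imp_le pos2 real_sqrt_pow2)
    then have "sqrt (1 + \<tau>\<^sup>2) < s / gam \<epsilon>"
      using \<open>1 < s / gam \<epsilon>\<close> by (intro real_less_lsqrt) auto
    then have lt: "sqrt (1 + \<tau>\<^sup>2) * gam \<epsilon> < s" using gm by (simp add: pos_less_divide_eq)
    have "0 < sqrt (1 + \<tau>\<^sup>2) * gam \<epsilon>" using gm by (intro mult_pos_pos) (auto simp: add_pos_nonneg)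
    then have "(b - \<epsilon>) / (1 - \<epsilon>) < g (sqrt (1 + \<tau>\<^sup>2) * gam \<epsilon>)" using g_strict[OF _ lt] s by simp
    then have "b < (1 - \<epsilon>) * g (sqrt (1 + \<tau>\<^sup>2) * gam \<epsilon>) + \<epsilon>"
      using \<epsilon>1 by (simp add: pos_divide_less_eq algebra_simps)
    then show "w \<le> max_bias T \<epsilon>" unfolding \<tau> using max_bias_S_ge[OF T \<epsilon>] \<open>0 < \<tau>\<close> by simp
  qed
qed

text \<open>A value below 1 that \<open>g\<close> misses lies below all values of \<open>g\<close>,
  so \<open>max_bias_S_ge\<close> applies to arbitrarily large \<tau>.\<close>

lemma max_bias_S_infinite:
  fixes T :: "(real \<times> 'a::euclidean_space) measure \<Rightarrow> 'a option"
  assumes T: "S_slope \<rho> b T" and \<epsilon>: "0 < \<epsilon>" "\<epsilon> < 1 - b" and out: "(b - \<epsilon>) / (1 - \<epsilon>) \<notin> g ` {0<..}"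
  shows "max_bias T \<epsilon> = \<infinity>"
proof -
  have \<epsilon>1: "\<epsilon> < 1" using \<epsilon> b by simp
  have big: "(b - \<epsilon>) / (1 - \<epsilon>) < g t" if t: "0 < t" for t
  proof (rule ccontr)
    assume "\<not> ?thesis"
    moreover have "(b - \<epsilon>) / (1 - \<epsilon>) < 1" using \<epsilon>1 b by (simp add: pos_divide_less_eq)
    ultimately obtain s where "0 < s" "g s = (b - \<epsilon>) / (1 - \<epsilon>)"
      using g_onto[OF g_cont t] by (metis not_less)
    then show False using out by (metis greaterThan_iff image_eqI)
  qed
  have "ereal \<tau> \<le> max_bias T \<epsilon>" for \<tau>
  proof -
    have "0 < sqrt (1 + \<bar>\<tau>\<bar>\<^sup>2) * gam \<epsilon>"
      using gam(1)[of \<epsilon>] \<epsilon> by (intro mult_pos_pos) (auto simp: add_pos_nonneg)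
    from big[OF this] have "b < (1 - \<epsilon>) * g (sqrt (1 + \<bar>\<tau>\<bar>\<^sup>2) * gam \<epsilon>) + \<epsilon>"
      using \<epsilon>1 by (simp add: pos_divide_less_eq algebra_simps)
    then have "ereal \<bar>\<tau>\<bar> \<le> max_bias T \<epsilon>" using max_bias_S_ge[OF T \<epsilon>] by simp
    moreover have "ereal \<tau> \<le> ereal \<bar>\<tau>\<bar>" by simp
    ultimately show ?thesis by (rule order_trans[rotated])
  qed
  then show ?thesis by (rule ereal_top)
qed

section \<open>Upper bounds for the maximum bias of the CM-estimate\<close>

lemma CM_bound_mono:
  assumes c: "0 < c" "c \<le> 1 / phi0" and \<epsilon>: "0 < \<epsilon>" "\<epsilon> < 1 - b"
    and s: "gam \<epsilon> \<le> s" "b - \<epsilon> \<le> (1 - \<epsilon>) * g s"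
  shows "c * b + ln (gam \<epsilon>) \<le> c * (1 - \<epsilon>) * g s + ln s"
proof -
  have \<epsilon>1: "\<epsilon> < 1" using \<epsilon> b by simp
  have gm: "0 < gam \<epsilon>" "(1 - \<epsilon>) * g (gam \<epsilon>) = b" "gam \<epsilon> \<le> s0" using gam[of \<epsilon>] \<epsilon> \<epsilon>1 by auto
  have "0 < s" using gm s by simp
  \<comment> \<open>Multiplying by \<open>c\<close> and using \<open>c * phi0 \<le> 1\<close> turns
    this into the claim, whose left side is the right side evaluated at
    \<open>gam \<epsilon>\<close>.\<close>
  have key: "b - (1 - \<epsilon>) * g s \<le> phi0 * ln (s / gam \<epsilon>)"
  proof (cases "s0 < s")
    case True
    then show ?thesis using ln_ratio_gam[OF \<epsilon> True s(2)] by simp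
  next
    case False
    have "g s \<le> g (gam \<epsilon>)" using g_antimono gm s by simp
    then have "(1 - \<epsilon>) * (g (gam \<epsilon>) - g s) \<le> g (gam \<epsilon>) - g s"
      using \<epsilon> by (intro mult_left_le_one_le) (use \<epsilon>1 in auto)
    moreover have "g (gam \<epsilon>) - g s \<le> phi0 * ln (s / gam \<epsilon>)"
      using ln_ratio_ge_left[OF gm(1) s(1)] False by simp
    ultimately show ?thesis using gm(2) by (simp add: right_diff_distrib)
  qed
  have "0 \<le> ln (s / gam \<epsilon>)" using s gm by simp
  then have "(c * phi0) * ln (s / gam \<epsilon>) \<le> 1 * ln (s / gam \<epsilon>)"
    using c phi0_pos by (intro mult_right_mono) (simp_all add: pos_le_divide_eq)
  moreover have "c * (b - (1 - \<epsilon>) * g s) \<le> c * (phi0 * ln (s / gam \<epsilon>))"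
    using key c by (intro mult_left_mono) auto
  ultimately have "c * (b - (1 - \<epsilon>) * g s) \<le> ln (s / gam \<epsilon>)" by (simp add: mult.assoc)
  then show ?thesis using \<open>0 < s\<close> gm by (simp add: ln_div algebra_simps)
qed

text \<open>Even if all contaminating mass had loss 1, the total at scale \<open>s\<close> would be
  \<open>(1 - \<epsilon>) * g s + \<epsilon> = b\<close>.\<close>

lemma scale_feasible:
  fixes H :: "(real \<times> 'a::euclidean_space) measure"
  assumes \<epsilon>: "0 < \<epsilon>" "\<epsilon> < 1" and H: "H \<in> contam_nbhd \<epsilon>"
    and s: "0 < s" "g s = (b - \<epsilon>) / (1 - \<epsilon>)" and t: "s \<le> t"
  shows "feasible \<rho> b H (0, 0, t)"
    and "mean_rho \<rho> H (0, 0, t) \<le> (1 - \<epsilon>) * g t + \<epsilon>"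
proof -
  have "mean_rho \<rho> H_o (0, 0 :: 'a, t) = g t" by (simp add: mean_rho_H_o_0)
  then show *: "mean_rho \<rho> H (0, 0, t) \<le> (1 - \<epsilon>) * g t + \<epsilon>"
    using mean_rho_contam(2)[OF H, of "(0, 0, t)"] \<epsilon> by simp
  have "(1 - \<epsilon>) * g t \<le> (1 - \<epsilon>) * g s" using g_antimono[OF s(1) t] \<epsilon> by (intro mult_left_mono) auto
  also have "\<dots> = b - \<epsilon>" using s \<epsilon> by simp
  finally show "feasible \<rho> b H (0, 0, t)" using * s t by (simp add: feasible_def)
qed

text \<open>The comparison scale \<open>t\<close> is left free: \<open>t = s\<close> serves the
  domination and \<open>t = \<sigma>M\<close> the strict inequality. The slack \<open>d\<close>
  allows for approximate minimizers.\<close>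

lemma CM_near_minimal:
  fixes H :: "(real \<times> 'a::euclidean_space) measure"
  assumes c: "0 < c" "c \<le> 1 / phi0" and \<epsilon>: "0 < \<epsilon>" "\<epsilon> < 1 - b" and H: "H \<in> contam_nbhd \<epsilon>"
    and s: "0 < s" "g s = (b - \<epsilon>) / (1 - \<epsilon>)" and t: "s \<le> t"
    and q: "feasible \<rho> b H (\<alpha>, \<theta>, \<sigma>)"
    and min: "\<And>q'. feasible \<rho> b H q' \<Longrightarrow> CM_objective \<rho> c H (\<alpha>, \<theta>, \<sigma>) < CM_objective \<rho> c H q' + d"
  shows "ln (sqrt (1 + (norm \<theta>)\<^sup>2)) \<le>
    max (c * \<epsilon>) (c * \<epsilon> + c * (1 - \<epsilon>) * g t + ln t - c * b - ln (gam \<epsilon>)) + d"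
proof -
  have \<epsilon>1: "\<epsilon> < 1" using \<epsilon> b by simp
  define \<tau> where "\<tau> = sqrt (1 + (norm \<theta>)\<^sup>2)"
  have "1 \<le> \<tau>" by (simp add: \<tau>_def)
  define r where "r = \<sigma> / \<tau>"
  have "0 < \<sigma>" using q by (simp add: feasible_def)
  then have "0 < r" using \<open>1 \<le> \<tau>\<close> by (simp add: r_def)
  have "gam \<epsilon> \<le> r" using feasible_bounds(2)[OF \<epsilon> H q] by (simp add: r_def \<tau>_def)
  have "(1 - \<epsilon>) * g r \<le> (1 - \<epsilon>) * mean_rho \<rho> H_o (\<alpha>, \<theta>, \<sigma>)"
    using mean_rho_H_o_ge[OF \<open>0 < \<sigma>\<close>, of \<theta> \<alpha>] \<epsilon>1 unfolding r_def \<tau>_def by (intro mult_left_mono) auto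
  also have "\<dots> \<le> mean_rho \<rho> H (\<alpha>, \<theta>, \<sigma>)"
    using mean_rho_contam(1)[OF H, of "(\<alpha>, \<theta>, \<sigma>)"] \<epsilon> \<epsilon>1 by simp
  finally have "c * ((1 - \<epsilon>) * g r) \<le> c * mean_rho \<rho> H (\<alpha>, \<theta>, \<sigma>)" using c by (intro mult_left_mono) auto
  moreover have "ln \<sigma> = ln r + ln \<tau>" using \<open>0 < \<sigma>\<close> \<open>1 \<le> \<tau>\<close> by (simp add: r_def ln_div)
  ultimately have lower: "c * (1 - \<epsilon>) * g r + ln r + ln \<tau> \<le> CM_objective \<rho> c H (\<alpha>, \<theta>, \<sigma>)"
    by (simp add: CM_objective_def)
  have upper: "CM_objective \<rho> c H (\<alpha>, \<theta>, \<sigma>) < c * (1 - \<epsilon>) * g t' + c * \<epsilon> + ln t' + d" if "s \<le> t'" for t'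
  proof -
    have "c * mean_rho \<rho> H (0, 0, t') \<le> c * ((1 - \<epsilon>) * g t' + \<epsilon>)"
      using scale_feasible(2)[OF \<epsilon>(1) \<epsilon>1 H s that] c by (intro mult_left_mono) auto
    then show ?thesis
      using min[OF scale_feasible(1)[OF \<epsilon>(1) \<epsilon>1 H s that]] by (simp add: CM_objective_def algebra_simps)
  qed
  show ?thesis
  proof (cases "s \<le> r")
    case True
    \<comment> \<open>The zero-slope fit with scale \<open>r\<close> is feasible; in the comparison
      the central terms and \<open>ln r\<close> cancel, leaving only the contamination cost.\<close>
    then have "ln \<tau> \<le> c * \<epsilon> + d" using lower upper[OF True] by linarith
    then show ?thesis unfolding \<tau>_def by linarith
  next
    case False
    then have "g s \<le> g r" using g_antimono[OF \<open>0 < r\<close>, of s] by simp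
    then have "(1 - \<epsilon>) * g s \<le> (1 - \<epsilon>) * g r" using \<epsilon>1 by (intro mult_left_mono) auto
    moreover have "(1 - \<epsilon>) * g s = b - \<epsilon>" using s \<epsilon>1 by simp
    ultimately have "c * b + ln (gam \<epsilon>) \<le> c * (1 - \<epsilon>) * g r + ln r"
      using CM_bound_mono[OF c \<epsilon> \<open>gam \<epsilon> \<le> r\<close>] by simp
    then have "ln \<tau> \<le> c * \<epsilon> + c * (1 - \<epsilon>) * g t + ln t - c * b - ln (gam \<epsilon>) + d"
      using lower upper[OF t] by linarith
    then show ?thesis unfolding \<tau>_def by linarith
  qed
qed

lemma CM_objective_ge:
  fixes H :: "(real \<times> 'a::euclidean_space) measure"
  assumes "0 < c" and \<epsilon>: "0 < \<epsilon>" "\<epsilon> < 1 - b" and H: "H \<in> contam_nbhd \<epsilon>" and q: "feasible \<rho> b H q"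
  shows "ln (snd (snd q)) \<le> CM_objective \<rho> c H q" "ln (gam \<epsilon>) \<le> CM_objective \<rho> c H q"
proof -
  obtain \<alpha> \<theta> \<sigma> where [simp]: "q = (\<alpha>, \<theta>, \<sigma>)" by (cases q)
  have "0 \<le> mean_rho \<rho> H q" by (auto simp: mean_rho_def intro!: integral_nonneg_AE)
  then show *: "ln (snd (snd q)) \<le> CM_objective \<rho> c H q" using assms(1) by (simp add: CM_objective_def)
  have "0 < \<sigma>" using q by (simp add: feasible_def)
  moreover have "gam \<epsilon> \<le> \<sigma>" using feasible_bounds(3)[OF \<epsilon> H] q by simp
  ultimately have "ln (gam \<epsilon>) \<le> ln \<sigma>" using gam(1)[of \<epsilon>] \<epsilon> by simp
  then show "ln (gam \<epsilon>) \<le> CM_objective \<rho> c H q" using * by simp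
qed

text \<open>Rules out \<open>None\<close>, which would count as infinite bias. Near-minimal feasible
  parameters lie in a compact set: the objective bounds the scale above,
  \<open>gam \<epsilon>\<close> bounds it below, the standardized scale bounds the slopes, and
  \<open>intercept_bounded\<close> the intercept.\<close>

lemma CM_solution_exists:
  fixes H :: "(real \<times> 'a::euclidean_space) measure"
  assumes c: "0 < c" and \<epsilon>: "0 < \<epsilon>" "\<epsilon> < 1 - b" and H: "H \<in> contam_nbhd \<epsilon>"
    and s: "0 < s" "g s = (b - \<epsilon>) / (1 - \<epsilon>)"
  shows "\<exists>q. solution (CM_objective \<rho> c H) (feasible \<rho> b H) q"
proof -
  have \<epsilon>1: "\<epsilon> < 1" using \<epsilon> b by simp
  have gm: "0 < gam \<epsilon>" using gam[of \<epsilon>] \<epsilon> by auto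
  let ?F = "CM_objective \<rho> c H" and ?P = "feasible \<rho> b H"
  let ?q0 = "(0, 0, s) :: real \<times> 'a \<times> real"
  define S where "S = exp (?F ?q0 + 1)"
  have "0 < S" by (simp add: S_def)
  have "b / (1 - \<epsilon>) < 1" using \<epsilon> \<epsilon>1 by (simp add: pos_divide_less_eq)
  then obtain A where A: "\<And>\<alpha> (\<theta> :: 'a) \<sigma>. 0 < \<sigma> \<Longrightarrow> \<sigma> \<le> S \<Longrightarrow>
    gam \<epsilon> \<le> \<sigma> / sqrt (1 + (norm \<theta>)\<^sup>2) \<Longrightarrow> mean_rho \<rho> H_o (\<alpha>, \<theta>, \<sigma>) \<le> b / (1 - \<epsilon>) \<Longrightarrow> \<bar>\<alpha>\<bar> \<le> A"
    using intercept_bounded[OF _ gm \<open>0 < S\<close>] by metis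
  define K where "K = {- A..A} \<times> cball (0 :: 'a) (S / gam \<epsilon>) \<times> {gam \<epsilon>..S}"
  show ?thesis
  proof (rule ex_solution[where K=K and m="ln (gam \<epsilon>)"])
    show "?P ?q0" using scale_feasible(1)[OF \<epsilon>(1) \<epsilon>1 H s] by simp
    show "ln (gam \<epsilon>) \<le> ?F q" if "?P q" for q using CM_objective_ge(2)[OF c \<epsilon> H that] .
    show "compact K" unfolding K_def by (intro compact_Times compact_cball compact_Icc)
    show "0 < snd (snd q)" if "q \<in> K" for q using that gm by (auto simp: K_def)
    fix q assume P: "?P q" and F: "?F q < ?F ?q0 + 1"
    obtain \<alpha> \<theta> \<sigma> where q: "q = (\<alpha>, \<theta>, \<sigma>)" by (cases q)
    note fb = feasible_bounds[OF \<epsilon> H P[unfolded q]]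
    have "0 < \<sigma>" using P by (simp add: q feasible_def)
    have "ln \<sigma> \<le> ?F ?q0 + 1" using CM_objective_ge(1)[OF c \<epsilon> H P] F by (simp add: q)
    then have "\<sigma> \<le> S" using \<open>0 < \<sigma>\<close> unfolding S_def by (metis exp_le_cancel_iff exp_ln)
    have "\<bar>\<alpha>\<bar> \<le> A" by (rule A[OF \<open>0 < \<sigma>\<close> \<open>\<sigma> \<le> S\<close> fb(2,1)])
    have "norm \<theta> \<le> sqrt (1 + (norm \<theta>)\<^sup>2)" by (rule real_le_rsqrt) simp
    also have "\<dots> \<le> \<sigma> / gam \<epsilon>"
    proof -
      show ?thesis
        using fb(2) gm sqrt_one_plus_pos[of \<theta>] by (simp add: pos_le_divide_eq mult.commute)
    qed
    also have "\<dots> \<le> S / gam \<epsilon>" using \<open>\<sigma> \<le> S\<close> gm by (simp add: divide_right_mono)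
    finally show "q \<in> K" using \<open>\<bar>\<alpha>\<bar> \<le> A\<close> \<open>\<sigma> \<le> S\<close> fb(3) by (auto simp: K_def q)
  qed
qed

text \<open>The bound of \<open>CM_near_minimal\<close> passes to limits of minimizing sequences,
  after which the slack tends to 0.\<close>

lemma max_bias_CM_le:
  fixes T :: "(real \<times> 'a::euclidean_space) measure \<Rightarrow> 'a option"
  assumes T: "CM_slope \<rho> b c T" and c: "0 < c" "c \<le> 1 / phi0" and \<epsilon>: "0 < \<epsilon>" "\<epsilon> < 1 - b"
    and s: "0 < s" "g s = (b - \<epsilon>) / (1 - \<epsilon>)" and t: "s \<le> t"
    and B: "c * \<epsilon> \<le> B" "c * \<epsilon> + c * (1 - \<epsilon>) * g t + ln t - c * b - ln (gam \<epsilon>) \<le> B"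
  shows "max_bias T \<epsilon> \<le> ereal (sqrt ((exp B)\<^sup>2 - 1))"
  unfolding max_bias_def
proof (rule SUP_least)
  fix H :: "(real \<times> 'a) measure" assume H: "H \<in> contam_nbhd \<epsilon>"
  have \<epsilon>1: "\<epsilon> < 1" using \<epsilon> b by simp
  have dist: "distribution H" using distribution_contam[OF H] \<epsilon> \<epsilon>1 by simp
  let ?F = "CM_objective \<rho> c H" and ?P = "feasible \<rho> b H"
  have sel: "case T H of None \<Rightarrow> \<not> (\<exists>q. solution ?F ?P q) | Some \<theta> \<Rightarrow> \<exists>\<alpha> \<sigma>. solution ?F ?P (\<alpha>, \<theta>, \<sigma>)"
    using T dist unfolding CM_slope_def selects_slopes_def by blast
  have "T H \<noteq> None"
  proof
    assume "T H = None"
    have "\<not> (\<exists>q. solution ?F ?P q)" using sel unfolding \<open>T H = None\<close> option.case .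
    with CM_solution_exists[OF c(1) \<epsilon> H s] show False by contradiction
  qed
  then obtain \<theta> where T\<theta>: "T H = Some \<theta>" by blast
  have "\<exists>\<alpha> \<sigma>. solution ?F ?P (\<alpha>, \<theta>, \<sigma>)" using sel unfolding T\<theta> option.case .
  then obtain \<alpha> \<sigma> where sol: "solution ?F ?P (\<alpha>, \<theta>, \<sigma>)" by blast
  have ml: "minimizing_limit ?F ?P (\<alpha>, \<theta>, \<sigma>)"
    by (rule solution_imp_minimizing_limit[OF sol feasible_scale_pos])
  obtain X where X: "X \<longlonglongrightarrow> (\<alpha>, \<theta>, \<sigma>)" "\<And>n. ?P (X n)"
    "\<And>d. 0 < d \<Longrightarrow> \<forall>\<^sub>F n in sequentially. \<forall>q'. ?P q' \<longrightarrow> ?F (X n) < ?F q' + d"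
    using minimizing_limit_near_minimal[OF ml CM_objective_ge(2)[OF c(1) \<epsilon> H]] by blast
  have lim: "(\<lambda>n. ln (sqrt (1 + (norm (fst (snd (X n))))\<^sup>2))) \<longlonglongrightarrow> ln (sqrt (1 + (norm (fst (snd (\<alpha>, \<theta>, \<sigma>))))\<^sup>2))"
    using add_pos_nonneg[OF zero_less_one zero_le_power2[of "norm \<theta>"]]
    by (intro tendsto_intros X(1)) auto
  have "ln (sqrt (1 + (norm \<theta>)\<^sup>2)) \<le> B + d" if "0 < d" for d
  proof -
    have "\<forall>\<^sub>F n in sequentially. ln (sqrt (1 + (norm (fst (snd (X n))))\<^sup>2)) \<le> B + d"
      using X(3)[OF that]
    proof eventually_elim
      fix n assume n: "\<forall>q'. ?P q' \<longrightarrow> ?F (X n) < ?F q' + d"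
      obtain \<alpha>' \<theta>' \<sigma>' where Xn: "X n = (\<alpha>', \<theta>', \<sigma>')" by (cases "X n")
      have "ln (sqrt (1 + (norm \<theta>')\<^sup>2)) \<le>
          max (c * \<epsilon>) (c * \<epsilon> + c * (1 - \<epsilon>) * g t + ln t - c * b - ln (gam \<epsilon>)) + d"
        using n X(2)[of n] unfolding Xn by (intro CM_near_minimal[OF c \<epsilon> H s t]) auto
      then show "ln (sqrt (1 + (norm (fst (snd (X n))))\<^sup>2)) \<le> B + d" using B by (simp add: Xn)
    qed
    then show ?thesis using tendsto_upperbound[OF lim] by simp
  qed
  then have "ln (sqrt (1 + (norm \<theta>)\<^sup>2)) \<le> B" by (rule field_le_epsilon)
  then have "sqrt (1 + (norm \<theta>)\<^sup>2) \<le> exp B"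
    using sqrt_one_plus_pos[of \<theta>] by (metis exp_le_cancel_iff exp_ln)
  then have "1 + (norm \<theta>)\<^sup>2 \<le> (exp B)\<^sup>2" by (rule sqrt_le_D)
  then have "norm \<theta> \<le> sqrt ((exp B)\<^sup>2 - 1)" by (intro real_le_rsqrt) simp
  then show "bias T H \<le> ereal (sqrt ((exp B)\<^sup>2 - 1))" by (simp add: bias_def T\<theta>)
qed

lemma c_eps_less:
  assumes c: "c \<le> 1 / phi0" and \<epsilon>: "0 < \<epsilon>" "\<epsilon> < 1 - b" and s: "0 < s" "g s = (b - \<epsilon>) / (1 - \<epsilon>)"
  shows "c * \<epsilon> < ln (s / gam \<epsilon>)"
proof -
  have "c * \<epsilon> \<le> 1 / phi0 * \<epsilon>" using c \<epsilon> by (intro mult_right_mono) auto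
  also have "\<dots> < ln (s / gam \<epsilon>)"
    using c_fun_gt[OF \<epsilon> s] phi0_pos by (simp add: pos_divide_less_eq mult.commute)
  finally show ?thesis .
qed

text \<open>If \<open>s\<close> exists, the choice \<open>t = s\<close> makes the second CM bound
  equal to \<open>ln (s / gam \<epsilon>)\<close>, exactly matching the lower bound for the
  S-estimate; otherwise the latter has infinite bias.\<close>

lemma max_bias_CM_le_S:
  fixes T_S T_CM :: "(real \<times> 'a::euclidean_space) measure \<Rightarrow> 'a option"
  assumes S: "S_slope \<rho> b T_S" and CM: "CM_slope \<rho> b c T_CM" and c: "0 < c" "c \<le> 1 / phi0"
    and \<epsilon>: "0 < \<epsilon>" "\<epsilon> < 1 - b"
  shows "max_bias T_CM \<epsilon> \<le> max_bias T_S \<epsilon>"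
proof (cases "(b - \<epsilon>) / (1 - \<epsilon>) \<in> g ` {0<..}")
  case False
  then show ?thesis using max_bias_S_infinite[OF S \<epsilon>] by simp
next
  case True
  then obtain s where s: "0 < s" "g s = (b - \<epsilon>) / (1 - \<epsilon>)" by auto
  have \<epsilon>1: "\<epsilon> < 1" using \<epsilon> b by simp
  have gm: "0 < gam \<epsilon>" using gam[of \<epsilon>] \<epsilon> by auto
  have "(1 - \<epsilon>) * g s = b - \<epsilon>" using s \<epsilon>1 by simp
  then have cg: "c * (1 - \<epsilon>) * g s = c * (b - \<epsilon>)" by (simp only: mult.assoc)
  have "c * \<epsilon> + c * (1 - \<epsilon>) * g s + ln s - c * b - ln (gam \<epsilon>) = ln (s / gam \<epsilon>)"
    unfolding cg using s(1) gm by (simp add: ln_div right_diff_distrib)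
  then have "max_bias T_CM \<epsilon> \<le> ereal (sqrt ((exp (ln (s / gam \<epsilon>)))\<^sup>2 - 1))"
    using c_eps_less[OF c(2) \<epsilon> s] by (intro max_bias_CM_le[OF CM c \<epsilon> s order_refl]) auto
  also have "exp (ln (s / gam \<epsilon>)) = s / gam \<epsilon>" using s gm by simp
  also have "ereal (sqrt ((s / gam \<epsilon>)\<^sup>2 - 1)) \<le> max_bias T_S \<epsilon>"
    by (rule max_bias_S_lower_bound[OF S \<epsilon> s])
  finally show ?thesis .
qed

text \<open>
  Strictness: for small \<open>\<epsilon>\<close> the candidate scale \<open>\<sigma>M\<close> beats \<open>\<sigma>\<^bsub>b,\<epsilon>\<^esub>\<close> in the CM objective,
  because \<open>c > c\<^sub>1\<close>.
\<close>

lemma max_bias_CM_less_S: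
  fixes T_S T_CM :: "(real \<times> 'a::euclidean_space) measure \<Rightarrow> 'a option"
  assumes S: "S_slope \<rho> b T_S" and CM: "CM_slope \<rho> b c T_CM" and c: "0 < c" "c \<le> 1 / phi0"
    and c1: "c_1 \<rho> b \<sigma>M < c"
  shows "\<exists>\<epsilon>. 0 < \<epsilon> \<and> \<epsilon> < min b (1 - b) \<and> max_bias T_CM \<epsilon> < max_bias T_S \<epsilon>"
proof -
  \<comment> \<open>The drop of \<open>c * g + ln\<close> from \<open>s0\<close> to
    \<open>\<sigma>M\<close>; it is positive precisely because \<open>c\<close> exceeds
    \<open>c_1\<close>.\<close>
  define \<kappa> where "\<kappa> = c * b + ln s0 - c * g \<sigma>M - ln \<sigma>M"
  have "ln (\<sigma>M / s0) < c * (b - g \<sigma>M)"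
    using c1 g_M by (simp add: c_1_def pos_divide_less_eq)
  then have "0 < \<kappa>" using s0 sigma_M_pos by (simp add: \<kappa>_def ln_div right_diff_distrib)
  \<comment> \<open>The first two terms keep \<epsilon> in the admissible range, the third places
    the scale \<open>s\<close> at or below \<open>\<sigma>M\<close>, and the last keeps the
    contamination cost \<open>c * \<epsilon>\<close> below the gain \<kappa>.\<close>
  define \<epsilon> where "\<epsilon> = min (min (b / 2) ((1 - b) / 2)) (min (b - g \<sigma>M) (\<kappa> / (2 * c)))"
  have \<epsilon>0: "0 < \<epsilon>" using b g_M \<open>0 < \<kappa>\<close> c by (simp add: \<epsilon>_def)
  have "\<epsilon> \<le> b / 2" "\<epsilon> \<le> (1 - b) / 2" "\<epsilon> \<le> b - g \<sigma>M" "\<epsilon> \<le> \<kappa> / (2 * c)"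
    unfolding \<epsilon>_def by linarith+
  then have \<epsilon>: "0 < \<epsilon>" "\<epsilon> < 1 - b" and "\<epsilon> < b" "g \<sigma>M \<le> b - \<epsilon>" "c * \<epsilon> < \<kappa>"
    using b c \<epsilon>0 \<open>0 < \<kappa>\<close> by (auto simp: field_simps)
  have \<epsilon>1: "\<epsilon> < 1" using \<epsilon> b by simp
  have "(b - \<epsilon>) * (1 - \<epsilon>) \<le> b - \<epsilon>" using \<open>\<epsilon> < b\<close> \<epsilon> by (intro mult_left_le) auto
  then have "b - \<epsilon> \<le> (b - \<epsilon>) / (1 - \<epsilon>)" using \<epsilon>1 by (simp add: pos_le_divide_eq)
  then have le: "g \<sigma>M \<le> (b - \<epsilon>) / (1 - \<epsilon>)" using \<open>g \<sigma>M \<le> b - \<epsilon>\<close> by linarith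
  have "(b - \<epsilon>) / (1 - \<epsilon>) < 1" using \<epsilon>1 b by (simp add: pos_divide_less_eq)
  then obtain s where s: "0 < s" "s \<le> \<sigma>M" "g s = (b - \<epsilon>) / (1 - \<epsilon>)"
    using g_onto[OF g_cont sigma_M_pos le] by metis
  have gm: "0 < gam \<epsilon>" using gam[of \<epsilon>] \<epsilon> by auto
  define B where "B = max (c * \<epsilon>) (c * \<epsilon> + c * (1 - \<epsilon>) * g \<sigma>M + ln \<sigma>M - c * b - ln (gam \<epsilon>))"
  have "c * \<epsilon> + c * (1 - \<epsilon>) * g \<sigma>M + ln \<sigma>M - c * b < ln s"
  proof -
    have "0 \<le> c * \<epsilon> * g \<sigma>M" using c \<epsilon> g_nonneg[of \<sigma>M] by simp
    then have "c * \<epsilon> + c * (1 - \<epsilon>) * g \<sigma>M + ln \<sigma>M - c * b < ln s0"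
      using \<open>c * \<epsilon> < \<kappa>\<close> by (simp add: \<kappa>_def algebra_simps)
    moreover have "ln s0 < ln s" using sigma_eps_gt[OF \<epsilon>(1) \<epsilon>1 s(1,3)] s0 s by simp
    ultimately show ?thesis by linarith
  qed
  then have "B < ln (s / gam \<epsilon>)"
    using c_eps_less[OF c(2) \<epsilon> s(1,3)] s gm by (simp add: B_def ln_div)
  then have "exp B < s / gam \<epsilon>" using s gm by (metis divide_pos_pos exp_less_mono exp_ln)
  then have "(exp B)\<^sup>2 < (s / gam \<epsilon>)\<^sup>2" by (intro power_strict_mono) auto
  then have lt: "ereal (sqrt ((exp B)\<^sup>2 - 1)) < ereal (sqrt ((s / gam \<epsilon>)\<^sup>2 - 1))" by simp
  have "max_bias T_CM \<epsilon> \<le> ereal (sqrt ((exp B)\<^sup>2 - 1))"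
    by (rule max_bias_CM_le[OF CM c \<epsilon> s(1,3,2)]) (simp_all add: B_def)
  also note lt
  also have "ereal (sqrt ((s / gam \<epsilon>)\<^sup>2 - 1)) \<le> max_bias T_S \<epsilon>"
    by (rule max_bias_S_lower_bound[OF S \<epsilon> s(1,3)])
  finally show ?thesis using \<epsilon> \<open>\<epsilon> < b\<close> by auto
qed

lemma c_1_pos: "0 < c_1 \<rho> b \<sigma>M"
  using s0 g_M by (simp add: c_1_def)

end

theorem theorem6p3:
  fixes \<rho> :: "real \<Rightarrow> real" and b \<sigma>M :: real
  assumes "cond_A3 \<rho>" and "cond_A4 \<rho> \<sigma>M"
    and "0 < b" and "b < 1"
    and "g_fun \<rho> \<sigma>M < b"
    and "convex_on {0<..} (g_fun \<rho>)"
    and "phi_fun \<rho> (sigma_be \<rho> b 0) \<ge>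
           (1 - g_fun \<rho> \<sigma>M)\<^sup>2 * (1 - b) / (2 - (b + g_fun \<rho> \<sigma>M))"
  shows "c_o \<rho> b = 1 / phi_fun \<rho> (sigma_be \<rho> b 0) \<and>
    (\<forall>c. c_1 \<rho> b \<sigma>M < c \<and> c \<le> 1 / phi_fun \<rho> (sigma_be \<rho> b 0) \<longrightarrow>
       (\<forall>(T_S :: (real \<times> (real ^ 'p)) measure \<Rightarrow> (real ^ 'p) option) T_CM.
          S_slope \<rho> b T_S \<and> CM_slope \<rho> b c T_CM \<longrightarrow> dominates b T_CM T_S)) \<and>
    {c. c_1 \<rho> b \<sigma>M < c \<and> c \<le> 1 / phi_fun \<rho> (sigma_be \<rho> b 0)} \<noteq> {}"
proof -
  interpret cm_setting \<rho> b \<sigma>M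
    using assms by unfold_locales
  have "dominates b T_CM T_S"
    if c: "c_1 \<rho> b \<sigma>M < c" "c \<le> 1 / phi_fun \<rho> (sigma_be \<rho> b 0)"
      and S: "S_slope \<rho> b T_S" and CM: "CM_slope \<rho> b c T_CM"
    for c and T_S T_CM :: "(real \<times> (real ^ 'p)) measure \<Rightarrow> (real ^ 'p) option"
  proof -
    have "0 < c" using c(1) c_1_pos by simp
    then show ?thesis
      unfolding dominates_def
      using max_bias_CM_le_S[OF S CM _ c(2)] max_bias_CM_less_S[OF S CM _ c(2,1)] by auto
  qed
  moreover have "1 / phi_fun \<rho> (sigma_be \<rho> b 0) \<in> {c. c_1 \<rho> b \<sigma>M < c \<and> c \<le> 1 / phi_fun \<rho> (sigma_be \<rho> b 0)}"
    using c_1_less by simp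
  ultimately show ?thesis using c_o_eq by blast
qed

end
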